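(* Let $R\ge R_0=\|x^0-x^*\|$, $Q=B_{2R}(x^* )$, where $x^*$ is the unique solution of $F(x)=0$, and assume that $\mathbb{E}\|F_\xi(x)-F(x)\|^2\le\sigma^2$, $\langle F(x),x-x^*\rangle\ge\mu\|x-x^*\|^2$ and $\|F(x)\|^2\le\ell\langle F(x),x-x^*\rangle$ for all $x\in Q$, for some $\mu\ge0$ and $\ell>0$. Let $K\ge0$ and $\beta\in(0,1]$ be such that $\ln\frac{4(K+1)}\beta\ge1$. Consider clipped-SGDA with $\lambda_k=\frac{\exp(-\gamma\mu(1+k/2))R}{120\gamma\ln\frac{4(K+1)}\beta}$. Call (a) the condition $0<\gamma\le\frac1{400\ell\ln\frac{4(K+1)}\beta}$ and (b) the condition $m_k\ge\max\left\{1,\frac{27000\gamma^2(K+1)\sigma^2\ln\frac{4(K+1)}\beta}{\exp(-\gamma\mu k)R^2}\right\}$. Then the following statements hold. 1. (Large stepsize/large batch.) The choice $$\gamma=\frac1{400\ell\ln\frac{4(K+1)}\beta},\qquad m_k=\max\left\{1,\frac{27000\gamma^2(K+1)\sigma^2\ln\frac{4(K+1)}\beta}{\exp(-\gamma\mu k)R^2}\right\}$$ satisfies (a) and (b). With this choice, the iterates produced by clipped-SGDA after $K$ iterations with probability at least $1-\beta$ satisfy $$\|x^{K+1}-x^*\|^2\le2\exp\left(-\frac{\mu(K+1)}{400\ell\ln\frac{4(K+1)}\beta}\right)R^2.$$ In particular, to guarantee $\|x^{K+1}-x^*\|^2\le\varepsilon$ with probability at least $1-\beta$ for some $\varepsilon>0$,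 clipped-SGDA requires $O\left(\frac\ell\mu\ln\left(\frac{R^2}\varepsilon\right)\ln\left(\frac\ell{\mu\beta}\ln\left(\frac{R^2}\varepsilon\right)\right)\right)$ iterations and $O\left(\max\left\{\frac\ell\mu,\frac{\sigma^2}{\mu^2\varepsilon}\right\}\ln\left(\frac{R^2}\varepsilon\right)\ln\left(\frac\ell{\mu\beta}\ln\left(\frac{R^2}\varepsilon\right)\right)\right)$ oracle calls. 2. (Small stepsize/small batch.) The choice $$\gamma=\min\left\{\frac1{400\ell\ln\frac{4(K+1)}\beta},\frac{\ln(B_K)}{\mu(K+1)}\right\},\qquad m_k\equiv1$$ satisfies (a) and (b), where $$B_K=\max\left\{2,\frac{(K+1)\mu^2R^2}{27000\sigma^2\ln\left(\frac{4(K+1)}\beta\right)\ln^2(B_K)}\right\}=O\left(\max\left\{2,\frac{(K+1)\mu^2R^2}{27000\sigma^2\ln\left(\frac{4(K+1)}\beta\right)\ln^2\left(\max\left\{2,\frac{(K+1)\mu^2R^2}{27000\sigma^2\ln\left(\frac{4(K+1)}\beta\right)}\right\}\right)}\right\}\right).$$ With this choice, the iterates produced by clipped-SGDA after $K$ iterations with probability at least $1-\beta$ satisfy $$\|x^{K+1}-x^*\|^2\le\max\left\{2\exp\left(-\frac{\mu(K+1)}{400\ell\ln\frac{4(K+1)}\beta}\right)R^2,\frac{54000\sigma^2\ln\left(\frac{4(K+1)}\beta\right)\ln^2(B_K)}{\mu^2(K+1)}\right\}.$$ In particular, to guarantee $\|x^{K+1}-x^*\|^2\le\varepsilon$ with probability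 at least $1-\beta$ for some $\varepsilon>0$, clipped-SGDA requires $$O\left(\max\left\{\frac\ell\mu\ln\left(\frac{R^2}\varepsilon\right)\ln\left(\frac\ell{\mu\beta}\ln\left(\frac{R^2}\varepsilon\right)\right),\frac{\sigma^2}{\mu^2\varepsilon}\ln\left(\frac{\sigma^2}{\mu^2\varepsilon\beta}\right)\ln^2(B_\varepsilon)\right\}\right)$$ iterations/oracle calls, where $$B_\varepsilon=\max\left\{2,\frac{R^2}{\varepsilon\ln\left(\frac{\sigma^2}{\mu^2\varepsilon\beta}\right)\ln^2\left(\max\left\{2,\frac{R^2}{\varepsilon\ln\left(\frac{\sigma^2}{\mu^2\varepsilon\beta}\right)}\right\}\right)}\right\}.$$
   Context: Notation: $\|\cdot\|$ is the Euclidean norm, $B_r(x)=\{u\in\mathbb{R}^d:\|u-x\|\le r\}$. $F:\mathbb{R}^d\to\mathbb{R}^d$ with $F(x)=\mathbb{E}_{\xi\sim\mathcal D}[F_\xi(x)]$, where $F_\xi(x)$ is a stochastic oracle; $x^0$ is the starting point. $\mathrm{clip}(y,\lambda)=\min\{1,\lambda/\|y\|\}y$ for $y\ne0$, $\mathrm{clip}(0,\lambda)=0$, for $\lambda>0$. clipped-SGDA, for $k=0,1,\dots$: $x^{k+1}=x^k-\gamma\widetilde F_{\boldsymbol\xi^k}(x^k)$, $\widetilde F_{\boldsymbol\xi^k}(x^k)=\mathrm{clip}\left(\frac1{m_k}\sum_{i=1}^{m_k}F_{\xi^{i,k}}(x^k),\lambda_k\right)$, where all $\xi^{i,k}$ are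 independent samples from $\mathcal D$; $\gamma$ is the stepsize, $\lambda_k>0$ are clipping levels, $m_k$ are batchsizes. An oracle call is one evaluation of some $F_\xi(x)$; the total number of oracle calls is $\sum_{k=0}^Km_k$. $O(\cdot)$ hides numerical constants.
   Formalization: In item 2, (b) is claimed only if the second argument of the max for B_K is at least 2, and the probability bound only if (b) holds; σ>0, μ>0 where divided by; the O-bounds are for ε with logarithms at least 1, in item 2 with further conditions on ε that hold for all small ε. *)

theory Defs
  imports "HOL-Probability.Probability" "HOL-Real_Asymp.Real_Asymp"
begin

definition clip :: "'a::real_normed_vector \<Rightarrow> real \<Rightarrow> 'a" where
  "clip y lam = (if y = 0 then 0 else min 1 (lam / norm y) *\<^sub>R y)"

(* One trajectory of clipped-SGDA; xi k i is the realised i-th sample (i = 1..m k) of step k. *)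
primrec clipped_sgda ::
  "('s \<Rightarrow> 'a \<Rightarrow> 'a) \<Rightarrow> (nat \<Rightarrow> nat \<Rightarrow> 's) \<Rightarrow> real \<Rightarrow> (nat \<Rightarrow> real) \<Rightarrow> (nat \<Rightarrow> nat) \<Rightarrow> 'a \<Rightarrow> nat
    \<Rightarrow> 'a::real_normed_vector" where
  "clipped_sgda G xi \<gamma> lam m x0 0 = x0"
| "clipped_sgda G xi \<gamma> lam m x0 (Suc k) =
     (let x = clipped_sgda G xi \<gamma> lam m x0 k
      in x - \<gamma> *\<^sub>R clip ((1 / real (m k)) *\<^sub>R (\<Sum>i = 1..m k. G (xi k i) x)) (lam k))"

(* D is the law of the samples and G s x the oracle F_s(x).  Joint measurability of G makes the
   iterates random variables.  The variance is a nonnegative integral, so that the bound also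
   asserts square integrability.  R > 0 is what makes the clipping levels positive. *)
locale clipped_sgda_setting = M: prob_space M + D: prob_space D
  for M :: "'w measure" and D :: "'s measure" +
  fixes G :: "'s \<Rightarrow> 'a \<Rightarrow> 'a::euclidean_space" and F :: "'a \<Rightarrow> 'a"
    and \<xi> :: "nat \<Rightarrow> nat \<Rightarrow> 'w \<Rightarrow> 's"
    and x0 xs :: 'a and R \<mu> ell \<sigma> :: real
  assumes G_measurable: "(\<lambda>(s, x). G s x) \<in> borel_measurable (D \<Otimes>\<^sub>M borel)"
    and samples_indep: "M.indep_vars (\<lambda>_. D) (\<lambda>(k, i). \<xi> k i) UNIV"
    and samples_law: "\<And>k i. distr M D (\<xi> k i) = D"
    and F_mean: "\<And>x. has_bochner_integral D (\<lambda>s. G s x) (F x)"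
    and xs_unique_root: "\<And>x. F x = 0 \<longleftrightarrow> x = xs"
    and R_pos: "0 < R"
    and R_ge: "norm (x0 - xs) \<le> R"
    and mu_nonneg: "0 \<le> \<mu>"
    and ell_pos: "0 < ell"
    and sigma_nonneg: "0 \<le> \<sigma>"
    and variance_le: "\<And>x. x \<in> cball xs (2 * R) \<Longrightarrow>
          (\<integral>\<^sup>+ s. ennreal ((norm (G s x - F x))\<^sup>2) \<partial>D) \<le> ennreal (\<sigma>\<^sup>2)"
    and quasi_strongly_monotone: "\<And>x. x \<in> cball xs (2 * R) \<Longrightarrow>
          \<mu> * (norm (x - xs))\<^sup>2 \<le> F x \<bullet> (x - xs)"
    and star_cocoercive: "\<And>x. x \<in> cball xs (2 * R) \<Longrightarrow>
          (norm (F x))\<^sup>2 \<le> ell * (F x \<bullet> (x - xs))"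

definition logK :: "nat \<Rightarrow> real \<Rightarrow> real" where
  "logK K \<beta> = ln (4 * (real K + 1) / \<beta>)"

definition clip_level :: "real \<Rightarrow> real \<Rightarrow> real \<Rightarrow> nat \<Rightarrow> real \<Rightarrow> nat \<Rightarrow> real" where
  "clip_level \<gamma> \<mu> R K \<beta> k =
     exp (- \<gamma> * \<mu> * (1 + real k / 2)) * R / (120 * \<gamma> * logK K \<beta>)"

(* x^{K+1} as a random variable; the clipping levels depend on the horizon K. *)
definition sgda_output ::
  "('s \<Rightarrow> 'a \<Rightarrow> 'a) \<Rightarrow> (nat \<Rightarrow> nat \<Rightarrow> 'w \<Rightarrow> 's) \<Rightarrow> 'a \<Rightarrow> real \<Rightarrow> real \<Rightarrow> nat \<Rightarrow> real \<Rightarrow> real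
    \<Rightarrow> (nat \<Rightarrow> nat) \<Rightarrow> 'w \<Rightarrow> 'a::real_normed_vector" where
  "sgda_output G \<xi> x0 R \<mu> K \<beta> \<gamma> m \<omega> =
     clipped_sgda G (\<lambda>k i. \<xi> k i \<omega>) \<gamma> (clip_level \<gamma> \<mu> R K \<beta>) m x0 (K + 1)"

definition oracle_calls :: "(nat \<Rightarrow> nat) \<Rightarrow> nat \<Rightarrow> nat" where
  "oracle_calls m K = (\<Sum>k = 0..K. m k)"

definition batch_bound :: "real \<Rightarrow> real \<Rightarrow> real \<Rightarrow> real \<Rightarrow> nat \<Rightarrow> real \<Rightarrow> nat \<Rightarrow> real" where
  "batch_bound \<gamma> \<mu> R \<sigma> K \<beta> k =
     max 1 (27000 * \<gamma>\<^sup>2 * (real K + 1) * \<sigma>\<^sup>2 * logK K \<beta> / (exp (- \<gamma> * \<mu> * real k) * R\<^sup>2))"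

definition cond_a :: "real \<Rightarrow> nat \<Rightarrow> real \<Rightarrow> real \<Rightarrow> bool" where
  "cond_a ell K \<beta> \<gamma> \<longleftrightarrow> 0 < \<gamma> \<and> \<gamma> \<le> 1 / (400 * ell * logK K \<beta>)"

(* Only the steps 0..K are performed. *)
definition cond_b :: "real \<Rightarrow> real \<Rightarrow> real \<Rightarrow> nat \<Rightarrow> real \<Rightarrow> real \<Rightarrow> (nat \<Rightarrow> nat) \<Rightarrow> bool" where
  "cond_b \<mu> R \<sigma> K \<beta> \<gamma> m \<longleftrightarrow> (\<forall>k\<le>K. batch_bound \<gamma> \<mu> R \<sigma> K \<beta> k \<le> real (m k))"

definition gamma_large :: "real \<Rightarrow> nat \<Rightarrow> real \<Rightarrow> real" where
  "gamma_large ell K \<beta> = 1 / (400 * ell * logK K \<beta>)"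

(* Batch sizes are integers, so the real-valued formula is rounded up. *)
definition batch_large :: "real \<Rightarrow> real \<Rightarrow> real \<Rightarrow> real \<Rightarrow> nat \<Rightarrow> real \<Rightarrow> nat \<Rightarrow> nat" where
  "batch_large \<mu> ell R \<sigma> K \<beta> k = nat \<lceil>batch_bound (gamma_large ell K \<beta>) \<mu> R \<sigma> K \<beta> k\<rceil>"

definition rate_large :: "real \<Rightarrow> real \<Rightarrow> real \<Rightarrow> nat \<Rightarrow> real \<Rightarrow> real" where
  "rate_large \<mu> ell R K \<beta> = 2 * exp (- (\<mu> * (real K + 1) / (400 * ell * logK K \<beta>))) * R\<^sup>2"

definition B_arg :: "real \<Rightarrow> real \<Rightarrow> real \<Rightarrow> nat \<Rightarrow> real \<Rightarrow> real" where
  "B_arg \<mu> R \<sigma> K \<beta> = (real K + 1) * \<mu>\<^sup>2 * R\<^sup>2 / (27000 * \<sigma>\<^sup>2 * logK K \<beta>)"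

(* B_K is given by an implicit equation.  Its right-hand side is antitone in B on [2, oo) and
   every solution is >= 2, so the solution is unique.  When the second argument of max is below 2,
   unit batches need not satisfy the batch condition: for K = 0, beta = mu = ell = R = 1 and
   sigma = 100 we have B = 2, but the condition asks for m_0 > 1217. *)
definition B_K :: "real \<Rightarrow> real \<Rightarrow> real \<Rightarrow> nat \<Rightarrow> real \<Rightarrow> real" where
  "B_K \<mu> R \<sigma> K \<beta> = (THE B. B = max 2 (B_arg \<mu> R \<sigma> K \<beta> / (ln B)\<^sup>2))"

definition gamma_small :: "real \<Rightarrow> real \<Rightarrow> real \<Rightarrow> real \<Rightarrow> nat \<Rightarrow> real \<Rightarrow> real" where
  "gamma_small \<mu> ell R \<sigma> K \<beta> =
     min (1 / (400 * ell * logK K \<beta>)) (ln (B_K \<mu> R \<sigma> K \<beta>) / (\<mu> * (real K + 1)))"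

definition rate_small :: "real \<Rightarrow> real \<Rightarrow> real \<Rightarrow> real \<Rightarrow> nat \<Rightarrow> real \<Rightarrow> real" where
  "rate_small \<mu> ell R \<sigma> K \<beta> =
     max (2 * exp (- (\<mu> * (real K + 1) / (400 * ell * logK K \<beta>))) * R\<^sup>2)
         (54000 * \<sigma>\<^sup>2 * logK K \<beta> * (ln (B_K \<mu> R \<sigma> K \<beta>))\<^sup>2 / (\<mu>\<^sup>2 * (real K + 1)))"

definition B_eps :: "real \<Rightarrow> real \<Rightarrow> real \<Rightarrow> real \<Rightarrow> real \<Rightarrow> real" where
  "B_eps \<mu> R \<sigma> \<beta> \<epsilon> =
     (let w = ln (\<sigma>\<^sup>2 / (\<mu>\<^sup>2 * \<epsilon> * \<beta>))
      in max 2 (R\<^sup>2 / (\<epsilon> * w * (ln (max 2 (R\<^sup>2 / (\<epsilon> * w))))\<^sup>2)))"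

definition iter_large :: "real \<Rightarrow> real \<Rightarrow> real \<Rightarrow> real \<Rightarrow> real \<Rightarrow> real" where
  "iter_large \<mu> ell R \<beta> \<epsilon> =
     ell / \<mu> * ln (R\<^sup>2 / \<epsilon>) * ln (ell / (\<mu> * \<beta>) * ln (R\<^sup>2 / \<epsilon>))"

definition calls_large :: "real \<Rightarrow> real \<Rightarrow> real \<Rightarrow> real \<Rightarrow> real \<Rightarrow> real \<Rightarrow> real" where
  "calls_large \<mu> ell R \<sigma> \<beta> \<epsilon> =
     max (ell / \<mu>) (\<sigma>\<^sup>2 / (\<mu>\<^sup>2 * \<epsilon>)) * ln (R\<^sup>2 / \<epsilon>) * ln (ell / (\<mu> * \<beta>) * ln (R\<^sup>2 / \<epsilon>))"

definition iter_small :: "real \<Rightarrow> real \<Rightarrow> real \<Rightarrow> real \<Rightarrow> real \<Rightarrow> real \<Rightarrow> real" where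
  "iter_small \<mu> ell R \<sigma> \<beta> \<epsilon> =
     max (ell / \<mu> * ln (R\<^sup>2 / \<epsilon>) * ln (ell / (\<mu> * \<beta>) * ln (R\<^sup>2 / \<epsilon>)))
         (\<sigma>\<^sup>2 / (\<mu>\<^sup>2 * \<epsilon>) * ln (\<sigma>\<^sup>2 / (\<mu>\<^sup>2 * \<epsilon> * \<beta>)) * (ln (B_eps \<mu> R \<sigma> \<beta> \<epsilon>))\<^sup>2)"

(* The O-bounds are non-asymptotic with a numerical constant.  They are stated for accuracies at
   which the logarithms in them are at least 1 (as eps approaches R^2 the bounds tend to 0, while
   at least one iteration is performed). *)
definition eps_regime_large :: "real \<Rightarrow> real \<Rightarrow> real \<Rightarrow> real \<Rightarrow> real \<Rightarrow> bool" where
  "eps_regime_large \<mu> ell R \<beta> \<epsilon> \<longleftrightarrow>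
     0 < \<epsilon> \<and> 1 \<le> ln (R\<^sup>2 / \<epsilon>) \<and> 1 \<le> ln (ell / (\<mu> * \<beta>) * ln (R\<^sup>2 / \<epsilon>))"

(* For small batches, the rate is at most eps exactly when (K+1) / ln (4(K+1)/beta) is at least
     max (400 ell/mu ln (2R^2/eps)) (54000 sigma^2/(mu^2 eps) ln^2 (2R^2/eps)).
   Either the noise part is dominated, or it is to be absorbed by the noise term of the O-bound;
   the latter needs ln ln (R^2/eps) to be at most the logarithm W = ln (sigma^2/(mu^2 eps beta))
   kept in that term, and W^2 <= R^2/eps for ln B_eps to be of the order of ln (R^2/eps). *)
definition eps_regime_small :: "real \<Rightarrow> real \<Rightarrow> real \<Rightarrow> real \<Rightarrow> real \<Rightarrow> real \<Rightarrow> bool" where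
  "eps_regime_small \<mu> ell R \<sigma> \<beta> \<epsilon> \<longleftrightarrow>
     eps_regime_large \<mu> ell R \<beta> \<epsilon> \<and>
     (\<sigma>\<^sup>2 / (\<mu>\<^sup>2 * \<epsilon>) * ln (R\<^sup>2 / \<epsilon>) \<le> ell / \<mu> \<or>
      1 \<le> ln (\<sigma>\<^sup>2 / (\<mu>\<^sup>2 * \<epsilon> * \<beta>)) \<and>
      ln (ln (R\<^sup>2 / \<epsilon>)) \<le> ln (\<sigma>\<^sup>2 / (\<mu>\<^sup>2 * \<epsilon> * \<beta>)) \<and>
      (ln (\<sigma>\<^sup>2 / (\<mu>\<^sup>2 * \<epsilon> * \<beta>)))\<^sup>2 \<le> R\<^sup>2 / \<epsilon>)"

lemma eventually_eps_regime_large: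
  assumes "0 < \<mu>" "0 < ell" "0 < R" "0 < \<beta>"
  shows "\<forall>\<^sub>F \<epsilon> in at_right 0. eps_regime_large \<mu> ell R \<beta> \<epsilon>"
  unfolding eps_regime_large_def
  by (intro eventually_conj; use assms in real_asymp)

lemma eventually_eps_regime_small:
  assumes "0 < \<mu>" "0 < ell" "0 < R" "0 < \<beta>" "0 < \<sigma>"
  shows "\<forall>\<^sub>F \<epsilon> in at_right 0. eps_regime_small \<mu> ell R \<sigma> \<beta> \<epsilon>"
proof -
  have "\<forall>\<^sub>F \<epsilon> in at_right 0. 1 \<le> ln (\<sigma>\<^sup>2 / (\<mu>\<^sup>2 * \<epsilon> * \<beta>))"
    using assms by real_asymp
  moreover have "\<forall>\<^sub>F \<epsilon> in at_right 0. ln (ln (R\<^sup>2 / \<epsilon>)) \<le> ln (\<sigma>\<^sup>2 / (\<mu>\<^sup>2 * \<epsilon> * \<beta>))"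
    using assms by real_asymp
  moreover have "\<forall>\<^sub>F \<epsilon> in at_right 0. (ln (\<sigma>\<^sup>2 / (\<mu>\<^sup>2 * \<epsilon> * \<beta>)))\<^sup>2 \<le> R\<^sup>2 / \<epsilon>"
    using assms by real_asymp
  ultimately show ?thesis
    using eventually_eps_regime_large[OF assms(1-4)]
    unfolding eps_regime_small_def by eventually_elim auto
qed

end

(* With L = ln (4 (K + 1) / beta), y_t = exp (gamma mu t) |x^t - xs|^2 / R^2 and A_t the event that
   y_j <= 2 for all j <= t, the process that is exp (2 L y_t) on A_t and exp (4 L) off A_t grows in
   expectation by a factor of at most exp (L / (50 (K + 1))) per step: on A_t the iterate is in Q,
   its clipped update raises the exponent 2 L y_t by at most 1, and the clipping bias and the variance
   contribute O(L / (K + 1)) to it by the batch condition.  Hence exp (4 L) P(not A_(K+1)) <=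
   exp (L / 50 + 2 L), which gives failure probability at most exp (- L) <= beta without a union bound
   over the steps and without martingale concentration inequalities.

   The complexity bounds reduce to (K + 1) / L >= c T for a threshold T.  For small batches, the rate
   is at most eps once A_K / (ln rho)^2 >= rho for rho = 2 R^2 / eps, as this forces B_K >= rho. *)
theory Submission
  imports Defs
begin

subsection \<open>Clipping and one deterministic step\<close>

text \<open>Two obstacles shape the argument: the noise has only a second moment, and the variance
  bound and the structural assumptions on \<open>F\<close> hold only in the ball \<open>Q\<close>.
  Clipping answers the first. The clipped noise is bounded, so its exponential moment is governed by
  its first two moments through \<open>exp z \<le> 1 + z + z\<^sup>2\<close>; the price is a bias of
  the order of the variance over the clipping level. Stopping answers the second. Off
  \<open>A\<close> the process keeps the value \<open>exp (4 * L)\<close> that it has on the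
  boundary \<open>y = 2\<close>, so stopping never increases it. The coefficient
  \<open>2 * L\<close> creates the margin: the start is at most \<open>exp (2 * L)\<close> and
  failure costs \<open>exp (4 * L)\<close>, so a drift of up to \<open>L\<close> in the exponent
  still leaves \<open>exp (- L)\<close>. The weight \<open>exp (\<gamma> * \<mu> * t)\<close>
  cancels the contraction of the exact step. The region \<open>y \<le> 2\<close> shrinks
  accordingly, and the clipping level is tuned to its radius at time \<open>t\<close>.\<close>

lemma clip_eq_self: "norm y \<le> lam \<Longrightarrow> clip y lam = y"
  by (auto simp: clip_def min_def divide_simps)

lemma clip_eq_scaled: "0 < lam \<Longrightarrow> lam < norm y \<Longrightarrow> clip y lam = (lam / norm y) *\<^sub>R y"
  by (auto simp: clip_def min_def divide_simps)

lemma norm_clip_le: "0 < lam \<Longrightarrow> norm (clip y lam) \<le> lam"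
  by (cases "norm y \<le> lam") (auto simp: clip_eq_self clip_eq_scaled)

lemma measurable_clip [measurable]:
  "(\<lambda>y::'a::euclidean_space. clip y lam) \<in> borel_measurable borel"
  unfolding clip_def by measurable

text \<open>\<open>clip\<close> is the metric projection onto the ball of radius \<open>lam\<close>,
  and \<open>f\<close> lies in this ball. It serves to bound the second moment of the clipped noise
  by the variance of the unclipped one.\<close>

lemma norm_clip_diff_le:
  fixes y f :: "'a::real_inner"
  assumes "0 < lam" "norm f \<le> lam"
  shows "norm (clip y lam - f) \<le> norm (y - f)"
proof (cases "norm y \<le> lam")
  case False
  define c where "c = lam / norm y"
  have c: "0 < c" "c < 1" "c * norm y = lam"
    using False assms by (auto simp: c_def divide_simps)
  have "y \<bullet> f \<le> norm y * norm f" by (rule norm_cauchy_schwarz)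
  also have "\<dots> \<le> norm y * lam" using assms by (intro mult_left_mono) auto
  also have "\<dots> = c * (norm y)\<^sup>2" using c by (simp add: power2_eq_square)
  finally have "2 * (y \<bullet> f) \<le> 2 * c * (norm y)\<^sup>2" by simp
  also have "\<dots> \<le> (1 + c) * (norm y)\<^sup>2" using c by (intro mult_right_mono) auto
  finally have "0 \<le> (1 - c) * ((1 + c) * (norm y)\<^sup>2 - 2 * (y \<bullet> f))" using c by simp
  also have "\<dots> = (norm (y - f))\<^sup>2 - (norm (c *\<^sub>R y - f))\<^sup>2"
    unfolding power2_norm_eq_inner by (simp add: algebra_simps inner_commute)
  finally have "(norm (c *\<^sub>R y - f))\<^sup>2 \<le> (norm (y - f))\<^sup>2" by simp
  moreover have "clip y lam = c *\<^sub>R y" using False assms by (simp add: clip_eq_scaled c_def)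
  ultimately show ?thesis by (simp add: power2_le_iff_abs_le)
qed (simp add: clip_eq_self)

text \<open>When clipping is active it removes \<open>norm y - lam\<close>, which is at most
  \<open>a - lam / 2\<close> for \<open>a = norm (y - f)\<close>; this line is the tangent of the
  parabola \<open>a\<^sup>2 / (2 * lam)\<close> at \<open>a = lam\<close>. In expectation this
  bounds the clipping bias by the variance over \<open>2 * lam\<close>.\<close>

lemma norm_clip_minus_self_le:
  fixes y f :: "'a::real_normed_vector"
  assumes "0 < lam" "norm f \<le> lam / 2"
  shows "norm (clip y lam - y) \<le> (norm (y - f))\<^sup>2 / (2 * lam)"
proof (cases "norm y \<le> lam")
  case False
  define a where "a = norm (y - f)"
  have "clip y lam - y = (lam / norm y - 1) *\<^sub>R y"
    using False assms by (simp add: clip_eq_scaled algebra_simps)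
  then have "norm (clip y lam - y) = \<bar>lam / norm y - 1\<bar> * norm y"
    by simp
  also have "\<dots> = norm y - lam"
    using False assms by (auto simp: abs_if field_simps)
  also have "\<dots> \<le> a - lam / 2"
    using norm_triangle_sub[of y f] assms unfolding a_def by linarith
  also have "\<dots> \<le> a\<^sup>2 / (2 * lam)"
    using assms(1) sum_squares_ge_zero[of "a - lam" 0] by (simp add: field_simps power2_eq_square)
  finally show ?thesis by (simp add: a_def)
qed (use assms in \<open>simp add: clip_eq_self\<close>)

lemma norm_add_sq_scaled:
  fixes a b :: "'a::real_inner"
  shows "(norm (a + c *\<^sub>R b))\<^sup>2 = (norm a)\<^sup>2 + 2 * c * (a \<bullet> b) + c\<^sup>2 * (norm b)\<^sup>2"
  unfolding power2_norm_eq_inner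
  by (simp add: inner_simps inner_commute power2_eq_square[of c] distrib_left)

text \<open>Here \<open>u\<close> is \<open>x - xs\<close>, \<open>f\<close> is \<open>F x\<close>
  and \<open>v\<close> is the estimate used by the step. Cocoercivity pays for
  \<open>\<gamma>\<^sup>2 * (norm f)\<^sup>2\<close> with one of the two copies of
  \<open>\<gamma> * (f \<bullet> u)\<close>; monotonicity turns the other into the contraction. The
  last bound expands around the exact step, so the noise \<open>f - v\<close> is paired with a
  vector that does not depend on it.\<close>

lemma descent_step:
  fixes u f v :: "'a::real_inner"
  assumes "0 \<le> \<gamma>" "\<gamma> * ell \<le> 1" "\<mu> * (norm u)\<^sup>2 \<le> f \<bullet> u" "(norm f)\<^sup>2 \<le> ell * (f \<bullet> u)"
    and "0 \<le> \<mu>"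
  shows "norm (u - \<gamma> *\<^sub>R f) \<le> norm u"
    and "(norm (u - \<gamma> *\<^sub>R v))\<^sup>2
      \<le> exp (- (\<gamma> * \<mu>)) * (norm u)\<^sup>2 + 2 * \<gamma> * ((u - \<gamma> *\<^sub>R f) \<bullet> (f - v)) + \<gamma>\<^sup>2 * (norm (f - v))\<^sup>2"
proof -
  have fu: "0 \<le> f \<bullet> u" using assms(3,5) by (meson mult_nonneg_nonneg order_trans zero_le_power2)
  have "\<gamma> * (\<gamma> * (norm f)\<^sup>2) \<le> \<gamma> * (\<gamma> * (ell * (f \<bullet> u)))"
    using assms by (intro mult_left_mono) auto
  also have "\<dots> = (\<gamma> * ell) * (\<gamma> * (f \<bullet> u))" by (simp add: algebra_simps)
  also have "\<dots> \<le> 1 * (\<gamma> * (f \<bullet> u))" using assms fu by (intro mult_right_mono) auto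
  finally have f: "\<gamma>\<^sup>2 * (norm f)\<^sup>2 \<le> \<gamma> * (f \<bullet> u)" by (simp add: power2_eq_square)
  have eq: "(norm (u - \<gamma> *\<^sub>R f))\<^sup>2 = (norm u)\<^sup>2 - 2 * (\<gamma> * (f \<bullet> u)) + \<gamma>\<^sup>2 * (norm f)\<^sup>2"
    unfolding power2_norm_eq_inner by (simp add: algebra_simps inner_commute power2_eq_square[of \<gamma>])
  have "\<gamma> * (\<mu> * (norm u)\<^sup>2) \<le> \<gamma> * (f \<bullet> u)" using assms by (intro mult_left_mono) auto
  then have "(norm (u - \<gamma> *\<^sub>R f))\<^sup>2 \<le> (1 - \<gamma> * \<mu>) * (norm u)\<^sup>2"
    using f eq by (simp add: algebra_simps)
  also have "\<dots> \<le> exp (- (\<gamma> * \<mu>)) * (norm u)\<^sup>2"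
    using exp_ge_add_one_self[of "- (\<gamma> * \<mu>)"] by (intro mult_right_mono) auto
  finally have *: "(norm (u - \<gamma> *\<^sub>R f))\<^sup>2 \<le> exp (- (\<gamma> * \<mu>)) * (norm u)\<^sup>2" .
  have "0 \<le> \<gamma> * (f \<bullet> u)" using assms fu by auto
  then have "(norm (u - \<gamma> *\<^sub>R f))\<^sup>2 \<le> (norm u)\<^sup>2" using eq f by linarith
  then show "norm (u - \<gamma> *\<^sub>R f) \<le> norm u" by (rule power2_le_imp_le) simp
  have "u - \<gamma> *\<^sub>R v = (u - \<gamma> *\<^sub>R f) + \<gamma> *\<^sub>R (f - v)" by (simp add: algebra_simps)
  then have "(norm (u - \<gamma> *\<^sub>R v))\<^sup>2 = (norm (u - \<gamma> *\<^sub>R f))\<^sup>2 + 2 * \<gamma> * ((u - \<gamma> *\<^sub>R f) \<bullet> (f - v)) + \<gamma>\<^sup>2 * (norm (f - v))\<^sup>2"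
    by (simp only: norm_add_sq_scaled)
  with * show "(norm (u - \<gamma> *\<^sub>R v))\<^sup>2
      \<le> exp (- (\<gamma> * \<mu>)) * (norm u)\<^sup>2 + 2 * \<gamma> * ((u - \<gamma> *\<^sub>R f) \<bullet> (f - v)) + \<gamma>\<^sup>2 * (norm (f - v))\<^sup>2"
    by simp
qed

lemma exp_le_quadratic:
  fixes z :: real
  assumes "z \<le> 1"
  shows "exp z \<le> 1 + z + z\<^sup>2"
proof (cases "0 \<le> z")
  case True
  then show ?thesis using exp_bound[of z] assms by simp
next
  case False
  define y where "y = - z"
  have y: "y > 0" using False by (simp add: y_def)
  have "1 + y \<le> exp y" by simp
  then have "exp (-y) \<le> inverse (1 + y)"
    unfolding exp_minus using y by (intro le_imp_inverse_le) auto
  \<comment> \<open>\<open>(1 + y) * (1 - y + y\<^sup>2) = 1 + y ^ 3\<close>.\<close>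
  also have "\<dots> \<le> 1 - y + y\<^sup>2"
    using y by (simp add: field_simps power2_eq_square)
  finally show ?thesis by (simp add: y_def)
qed

section \<open>Exponential moment of one clipped step\<close>

context prob_space
begin

text \<open>One step with the past frozen: \<open>u\<close> is \<open>x - xs\<close>,
  \<open>X\<close> the minibatch mean, \<open>N\<close> the number of steps. For
  \<open>r = exp (- (\<gamma> * \<mu> * t) / 2) * R\<close> the exponent on the right is
  \<open>2 * L * y\<close> at time \<open>t\<close> and the one on the left is the same quantity at
  time \<open>t + 1\<close>. Time enters only through \<open>r\<close>.\<close>

lemma expectation_exp_step_le:
  fixes X :: "'a \<Rightarrow> 'b::euclidean_space" and u f :: 'b
  assumes X: "integrable M X" "expectation X = f"
    and var: "integrable M (\<lambda>\<omega>. (norm (X \<omega> - f))\<^sup>2)" "expectation (\<lambda>\<omega>. (norm (X \<omega> - f))\<^sup>2) \<le> V"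
    and V: "V \<le> r\<^sup>2 / (27000 * \<gamma>\<^sup>2 * N * L)"
    and pos: "0 < r" "0 < \<gamma>" "1 \<le> L" "0 < N" "0 \<le> \<mu>" "\<mu> \<le> ell" "0 < ell"
    and \<gamma>: "\<gamma> \<le> 1 / (400 * ell * L)"
    and u: "(norm u)\<^sup>2 \<le> 2 * r\<^sup>2"
    and F: "\<mu> * (norm u)\<^sup>2 \<le> f \<bullet> u" "(norm f)\<^sup>2 \<le> ell * (f \<bullet> u)"
    and lam: "lam = exp (- (\<gamma> * \<mu>)) * r / (120 * \<gamma> * L)"
  shows "(\<integral>\<^sup>+ \<omega>. ennreal (exp (2 * L * exp (\<gamma> * \<mu>) / r\<^sup>2 * (norm (u - \<gamma> *\<^sub>R clip (X \<omega>) lam))\<^sup>2)) \<partial>M)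
    \<le> ennreal (exp (L / (50 * N)) * exp (2 * L / r\<^sup>2 * (norm u)\<^sup>2))"
proof -
  define e where "e = exp (\<gamma> * \<mu>)"
  define T where "T = 2 * L * e / r\<^sup>2"
  define \<eta> where "\<eta> = u - \<gamma> *\<^sub>R f"
  define w where "w \<omega> = f - clip (X \<omega>) lam" for \<omega>
  \<comment> \<open>\<open>Z\<close> bounds the increment of the exponent: the factor
    \<open>e\<close> in \<open>T\<close> cancels the contraction
    \<open>exp (- (\<gamma> * \<mu>))\<close> of \<open>descent_step\<close>, and only the noise
    terms remain.\<close>
  define Z where "Z \<omega> = T * (2 * \<gamma> * (\<eta> \<bullet> w \<omega>) + \<gamma>\<^sup>2 * (norm (w \<omega>))\<^sup>2)" for \<omega>
  have \<gamma>lL: "\<gamma> * ell * L \<le> 1 / 400" using \<gamma> pos by (simp add: field_simps)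
  have \<gamma>l: "\<gamma> * ell \<le> 1 / 400"
  proof -
    have "\<gamma> * ell * 1 \<le> \<gamma> * ell * L" using pos by (intro mult_left_mono) auto
    then show ?thesis using \<gamma>lL by simp
  qed
  have "\<gamma> * \<mu> \<le> \<gamma> * ell" using pos by (intro mult_left_mono) auto
  then have p: "0 \<le> \<gamma> * \<mu>" "\<gamma> * \<mu> \<le> 1 / 400" using \<gamma>l pos by (simp, linarith)
  have e1: "1 \<le> e" using p by (simp add: e_def)
  have e2: "e \<le> 101 / 100"
  proof -
    have "(\<gamma> * \<mu>)\<^sup>2 \<le> (1/400)\<^sup>2" using p by (intro power_mono) auto
    then show ?thesis using exp_bound[of "\<gamma> * \<mu>"] p by (simp add: e_def power2_eq_square)
  qed
  have em: "exp (- (\<gamma> * \<mu>)) = 1 / e" by (simp add: e_def exp_minus divide_inverse)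
  have lam': "lam = r / (120 * \<gamma> * L * e)" using lam em e1 by simp
  have lam0: "0 < lam" using lam' pos e1 by simp
  have fu: "0 \<le> f \<bullet> u" using F(1) pos(5) by (meson mult_nonneg_nonneg order_trans zero_le_power2)
  have f_le: "norm f \<le> ell * norm u"
  proof (cases "norm f = 0")
    case False
    have "norm f * norm f \<le> ell * (norm f * norm u)"
      using F(2) norm_cauchy_schwarz[of f u] pos(7)
      by (smt (verit) mult_left_mono power2_eq_square)
    then show ?thesis using False by (simp add: mult.assoc mult.left_commute)
  qed (use pos in auto)
  \<comment> \<open>1.42 is a rational upper bound for the square root of 2.\<close>
  have u': "norm u \<le> 142/100 * r"
  proof (rule power2_le_imp_le)
    have "(142/100 * r)\<^sup>2 = 20164/10000 * r\<^sup>2" by (simp add: power2_eq_square)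
    then show "(norm u)\<^sup>2 \<le> (142/100 * r)\<^sup>2" using u zero_le_power2[of r] by linarith
  qed (use pos in auto)
  \<comment> \<open>The claim reduces to
    \<open>240 * 1.42 * e * (\<gamma> * ell * L) \<le> 1\<close>, where 240 is twice the 120 of the
    clipping level; the 400 in the stepsize leaves \<open>340.8 * 1.01 / 400\<close>.\<close>
  have f_lam: "norm f \<le> lam / 2"
  proof -
    have "\<gamma> * ell * L * (240 * e * 142) \<le> 1 / 400 * (240 * e * 142)"
      using \<gamma>lL e1 by (intro mult_right_mono) auto
    also have "\<dots> \<le> 100" using e2 by simp
    finally have "ell * (142/100) * (240 * \<gamma> * L * e) \<le> 1" by (simp add: algebra_simps)
    then have "ell * (142/100) * (240 * \<gamma> * L * e) * r \<le> 1 * r" using pos by (intro mult_right_mono) auto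
    then have "ell * (142/100 * r) \<le> lam / 2" using pos e1 unfolding lam' by (simp add: field_simps)
    moreover have "ell * norm u \<le> ell * (142/100 * r)" using u' pos by (intro mult_left_mono) auto
    ultimately show ?thesis using f_le by linarith
  qed
  have \<eta>: "norm \<eta> \<le> 142/100 * r"
    using descent_step(1)[of \<gamma> ell \<mu> u f] pos \<gamma>l F u' by (simp add: \<eta>_def)
  have w_lam: "norm (w \<omega>) \<le> 3/2 * lam" for \<omega>
    using norm_triangle_ineq4[of f "clip (X \<omega>) lam"] f_lam norm_clip_le[OF lam0, of "X \<omega>"]
    unfolding w_def by linarith
  have Xm[measurable]: "X \<in> borel_measurable M" using X by auto
  have wm[measurable]: "w \<in> borel_measurable M" unfolding w_def by measurable
  have Zm[measurable]: "Z \<in> borel_measurable M" unfolding Z_def by measurable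
  have \<gamma>w: "\<gamma> * norm (w \<omega>) \<le> r / (80 * L * e)" for \<omega>
  proof -
    have "\<gamma> * norm (w \<omega>) \<le> \<gamma> * (3/2 * lam)" using w_lam pos by (intro mult_left_mono) auto
    also have "\<dots> = r / (80 * L * e)" unfolding lam' using pos e1 by (simp add: field_simps)
    finally show ?thesis .
  qed
  have \<gamma>w': "\<gamma> * norm (w \<omega>) \<le> r / 80" for \<omega>
  proof -
    have "1 * 1 \<le> L * e" using pos e1 by (intro mult_mono) auto
    then have "r / (80 * L * e) \<le> r / 80" using pos by (intro divide_left_mono) auto
    then show ?thesis using \<gamma>w[of \<omega>] by linarith
  qed
  have T0: "0 < T" using pos e1 by (simp add: T_def)
  \<comment> \<open>The 3 covers \<open>2 * 1.42\<close> from the inner product and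
    \<open>1 / 80\<close> from the square.\<close>
  have absZ: "\<bar>Z \<omega>\<bar> \<le> T * (3 * r * (\<gamma> * norm (w \<omega>)))" for \<omega>
  proof -
    have "\<bar>\<eta> \<bullet> w \<omega>\<bar> \<le> norm \<eta> * norm (w \<omega>)" by (rule Cauchy_Schwarz_ineq2)
    also have "\<dots> \<le> 142/100 * r * norm (w \<omega>)" using \<eta> by (intro mult_right_mono) auto
    finally have "\<gamma> * \<bar>\<eta> \<bullet> w \<omega>\<bar> \<le> \<gamma> * (142/100 * r * norm (w \<omega>))"
      using pos by (intro mult_left_mono) auto
    then have 1: "\<bar>2 * \<gamma> * (\<eta> \<bullet> w \<omega>)\<bar> \<le> 284/100 * r * (\<gamma> * norm (w \<omega>))"
      using pos by (simp add: abs_mult algebra_simps)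
    have "\<gamma>\<^sup>2 * (norm (w \<omega>))\<^sup>2 = (\<gamma> * norm (w \<omega>)) * (\<gamma> * norm (w \<omega>))" by (simp add: power2_eq_square)
    also have "\<dots> \<le> r / 80 * (\<gamma> * norm (w \<omega>))"
      using \<gamma>w'[of \<omega>] pos by (intro mult_right_mono) auto
    finally have 2: "\<gamma>\<^sup>2 * (norm (w \<omega>))\<^sup>2 \<le> r / 80 * (\<gamma> * norm (w \<omega>))" .
    have 3: "0 \<le> r * (\<gamma> * norm (w \<omega>))" "0 \<le> \<gamma>\<^sup>2 * (norm (w \<omega>))\<^sup>2" using pos by auto
    have "\<bar>2 * \<gamma> * (\<eta> \<bullet> w \<omega>) + \<gamma>\<^sup>2 * (norm (w \<omega>))\<^sup>2\<bar> \<le> 3 * (r * (\<gamma> * norm (w \<omega>)))"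
      using 1 2 3 by linarith
    then have "T * \<bar>2 * \<gamma> * (\<eta> \<bullet> w \<omega>) + \<gamma>\<^sup>2 * (norm (w \<omega>))\<^sup>2\<bar> \<le> T * (3 * (r * (\<gamma> * norm (w \<omega>))))"
      using T0 by (intro mult_left_mono) auto
    then show ?thesis using T0 by (simp add: Z_def abs_mult mult.assoc)
  qed
  have Z1: "\<bar>Z \<omega>\<bar> \<le> 1" for \<omega>
  proof -
    have "T * (3 * r * (\<gamma> * norm (w \<omega>))) \<le> T * (3 * r * (r / (80 * L * e)))"
      using \<gamma>w[of \<omega>] T0 pos by (intro mult_left_mono) auto
    also have "\<dots> = 6 / 80" unfolding T_def using pos e1 by (simp add: field_simps power2_eq_square)
    finally show ?thesis using absZ[of \<omega>] by linarith
  qed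
  define W2 where "W2 = expectation (\<lambda>\<omega>. (norm (w \<omega>))\<^sup>2)"
  have w_dev: "norm (w \<omega>) \<le> norm (X \<omega> - f)" for \<omega>
    using norm_clip_diff_le[OF lam0, of f "X \<omega>"] f_lam lam0 by (simp add: w_def norm_minus_commute)
  have w2int: "integrable M (\<lambda>\<omega>. (norm (w \<omega>))\<^sup>2)"
    by (rule Bochner_Integration.integrable_bound[OF var(1)]) (auto intro!: power_mono w_dev)
  have W2: "W2 \<le> V" "0 \<le> W2"
  proof -
    have "W2 \<le> expectation (\<lambda>\<omega>. (norm (X \<omega> - f))\<^sup>2)" unfolding W2_def
      by (rule integral_mono[OF w2int var(1)]) (auto intro!: power_mono w_dev)
    then show "W2 \<le> V" using var(2) by simp
    show "0 \<le> W2" unfolding W2_def by (rule integral_nonneg_AE) auto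
  qed
  have wint: "integrable M w"
    by (rule integrable_const_bound[of _ "3/2 * lam"]) (use w_lam in auto)
  \<comment> \<open>Since \<open>X\<close> has mean \<open>f\<close>, the mean of \<open>w\<close>
    is the mean of \<open>X - clip X\<close>, to which \<open>norm_clip_minus_self_le\<close>
    applies.\<close>
  have bias: "norm (expectation w) \<le> V / (2 * lam)"
  proof -
    have ci: "integrable M (\<lambda>\<omega>. clip (X \<omega>) lam)"
      by (rule integrable_const_bound[of _ lam]) (auto intro: norm_clip_le lam0)
    have "expectation w = f - expectation (\<lambda>\<omega>. clip (X \<omega>) lam)"
      unfolding w_def using ci by (simp add: prob_space)
    also have "\<dots> = - expectation (\<lambda>\<omega>. clip (X \<omega>) lam - X \<omega>)" using ci X by simp
    finally have "norm (expectation w) = norm (expectation (\<lambda>\<omega>. clip (X \<omega>) lam - X \<omega>))" by simp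
    also have "\<dots> \<le> expectation (\<lambda>\<omega>. norm (clip (X \<omega>) lam - X \<omega>))" by (rule integral_norm_bound)
    also have "\<dots> \<le> expectation (\<lambda>\<omega>. (norm (X \<omega> - f))\<^sup>2 / (2 * lam))"
    proof (rule integral_mono)
      show "integrable M (\<lambda>\<omega>. norm (clip (X \<omega>) lam - X \<omega>))" using ci X(1) by auto
      show "integrable M (\<lambda>\<omega>. (norm (X \<omega> - f))\<^sup>2 / (2 * lam))" using var(1) by auto
    qed (rule norm_clip_minus_self_le[OF lam0 f_lam])
    also have "\<dots> = expectation (\<lambda>\<omega>. (norm (X \<omega> - f))\<^sup>2) / (2 * lam)" by simp
    also have "\<dots> \<le> V / (2 * lam)" using var(2) lam0 by (intro divide_right_mono) auto
    finally show ?thesis .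
  qed
  have V0: "0 \<le> V" using W2 by simp
  have V1: "\<gamma>\<^sup>2 * V * (27000 * N * L) \<le> r\<^sup>2"
    using V pos by (simp add: field_simps)
  \<comment> \<open>\<open>q\<close> is the variance bound relative to the current radius; the batch
    condition says \<open>q \<le> 1 / (27000 * N * L)\<close>.\<close>
  define q where "q = \<gamma>\<^sup>2 * V / r\<^sup>2"
  have q: "0 \<le> q" "q * (27000 * N * L) \<le> 1" "q * r\<^sup>2 = \<gamma>\<^sup>2 * V"
    using V0 V1 pos by (auto simp: q_def field_simps)
  have Zint: "integrable M Z"
    by (rule integrable_const_bound[of _ 1]) (auto simp: Z1)
  have Z2int: "integrable M (\<lambda>\<omega>. (Z \<omega>)\<^sup>2)"
    by (rule integrable_const_bound[of _ 1]) (auto simp: Z1 abs_square_le_1)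
  \<comment> \<open>The bias dominates: dividing by \<open>lam\<close> brings a second factor
    \<open>L\<close> and the constant \<open>1.42 * 120 = 170.4\<close>; finally
    \<open>2 * 1.01 * (171 * 1.01 + 1) < 352\<close>.\<close>
  have EZ: "expectation Z \<le> 352 * L\<^sup>2 * q"
  proof -
    have i1: "integrable M (\<lambda>\<omega>. \<eta> \<bullet> w \<omega>)" using wint by auto
    have "expectation Z = T * (2 * \<gamma> * (\<eta> \<bullet> expectation w) + \<gamma>\<^sup>2 * W2)"
      unfolding Z_def W2_def using i1 w2int wint by simp
    also have "\<dots> \<le> T * (342 * e * L / 2 * (\<gamma>\<^sup>2 * V) + \<gamma>\<^sup>2 * V)"
    proof (intro mult_left_mono add_mono)
      have "\<eta> \<bullet> expectation w \<le> norm \<eta> * norm (expectation w)" by (rule norm_cauchy_schwarz)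
      also have "\<dots> \<le> (142/100 * r) * (V / (2 * lam))" using \<eta> bias pos by (intro mult_mono) auto
      finally have "2 * \<gamma> * (\<eta> \<bullet> expectation w) \<le> 2 * \<gamma> * ((142/100 * r) * (V / (2 * lam)))"
        using pos by (intro mult_left_mono) auto
      also have "\<dots> = 1704 / 10 * e * L * (\<gamma>\<^sup>2 * V)"
        unfolding lam' using pos e1 by (simp add: field_simps power2_eq_square)
      also have "\<dots> \<le> 342 * e * L / 2 * (\<gamma>\<^sup>2 * V)" using pos e1 V0 by (intro mult_right_mono) auto
      finally show "2 * \<gamma> * (\<eta> \<bullet> expectation w) \<le> 342 * e * L / 2 * (\<gamma>\<^sup>2 * V)" .
    qed (use W2 T0 in auto)
    also have "\<dots> = 2 * L * e * q * (171 * e * L + 1)"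
      unfolding T_def q(3)[symmetric] using pos by (simp add: field_simps power2_eq_square)
    also have "\<dots> \<le> 2 * L * (101/100) * q * (171 * (101/100) * L + L)"
      using pos e1 e2 q by (intro mult_mono add_mono) auto
    also have "\<dots> = L\<^sup>2 * q * (2 * (101/100) * (171 * (101/100) + 1))" by (simp add: power2_eq_square algebra_simps)
    also have "\<dots> \<le> L\<^sup>2 * q * 352" using q by (intro mult_left_mono) auto
    finally show ?thesis by (simp add: algebra_simps)
  qed
  \<comment> \<open>Here \<open>T * 3 * r * r = 6 * L * e\<close>, and
    \<open>36 * 1.01\<^sup>2 < 37\<close>.\<close>
  have EZ2: "expectation (\<lambda>\<omega>. (Z \<omega>)\<^sup>2) \<le> 37 * L\<^sup>2 * q"
  proof -
    have "expectation (\<lambda>\<omega>. (Z \<omega>)\<^sup>2) \<le> expectation (\<lambda>\<omega>. (T * 3 * r * \<gamma>)\<^sup>2 * (norm (w \<omega>))\<^sup>2)"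
    proof (rule integral_mono[OF Z2int])
      show "(Z \<omega>)\<^sup>2 \<le> (T * 3 * r * \<gamma>)\<^sup>2 * (norm (w \<omega>))\<^sup>2" for \<omega>
        using power_mono[OF absZ[of \<omega>], of 2] by (simp add: power_mult_distrib mult_ac)
    qed (use w2int in auto)
    also have "\<dots> = (T * 3 * r * \<gamma>)\<^sup>2 * W2" by (simp add: W2_def)
    also have "\<dots> \<le> (T * 3 * r * \<gamma>)\<^sup>2 * V" using W2 by (intro mult_left_mono) auto
    also have "\<dots> = (T * 3 * r)\<^sup>2 * (q * r\<^sup>2)" unfolding q(3) by (simp add: power_mult_distrib)
    also have "\<dots> = L\<^sup>2 * q * (36 * e\<^sup>2)"
      unfolding T_def using pos by (simp add: field_simps power2_eq_square)
    also have "\<dots> \<le> L\<^sup>2 * q * 37"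
    proof -
      have "e\<^sup>2 \<le> (101/100)\<^sup>2" using e1 e2 by (intro power_mono) auto
      then show ?thesis using q by (intro mult_left_mono) (auto simp: power2_eq_square)
    qed
    finally show ?thesis by (simp add: algebra_simps)
  qed
  have "expectation (\<lambda>\<omega>. 1 + Z \<omega> + (Z \<omega>)\<^sup>2) = 1 + expectation Z + expectation (\<lambda>\<omega>. (Z \<omega>)\<^sup>2)"
    using Zint Z2int by (simp add: prob_space)
  also have "\<dots> \<le> 1 + 389 * L\<^sup>2 * q" using EZ EZ2 by simp
  \<comment> \<open>The batch condition replaces one factor \<open>L * q\<close> by
    \<open>1 / (27000 * N)\<close>, and \<open>(352 + 37) * 50 < 27000\<close>.\<close>
  also have "\<dots> \<le> 1 + L / (50 * N)"
  proof -
    have "389 * L\<^sup>2 * q * (50 * N) = L * (q * (27000 * N * L)) * (389 * 50 / 27000)"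
      by (simp add: power2_eq_square)
    also have "\<dots> \<le> L * 1 * 1" using q pos by (intro mult_mono) auto
    finally show ?thesis using pos by (simp add: field_simps)
  qed
  also have "\<dots> \<le> exp (L / (50 * N))" by (rule exp_ge_add_one_self)
  finally have fin: "expectation (\<lambda>\<omega>. 1 + Z \<omega> + (Z \<omega>)\<^sup>2) \<le> exp (L / (50 * N))" .
  have pt: "exp (2 * L * exp (\<gamma> * \<mu>) / r\<^sup>2 * (norm (u - \<gamma> *\<^sub>R clip (X \<omega>) lam))\<^sup>2)
      \<le> exp (2 * L / r\<^sup>2 * (norm u)\<^sup>2) * (1 + Z \<omega> + (Z \<omega>)\<^sup>2)" for \<omega>
  proof -
    have "T * (norm (u - \<gamma> *\<^sub>R clip (X \<omega>) lam))\<^sup>2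
      \<le> T * (exp (- (\<gamma> * \<mu>)) * (norm u)\<^sup>2 + 2 * \<gamma> * (\<eta> \<bullet> w \<omega>) + \<gamma>\<^sup>2 * (norm (w \<omega>))\<^sup>2)"
      unfolding \<eta>_def w_def
      using descent_step(2)[of \<gamma> ell \<mu> u f "clip (X \<omega>) lam"] pos \<gamma>l F T0 by (intro mult_left_mono) auto
    also have "\<dots> = 2 * L / r\<^sup>2 * (norm u)\<^sup>2 + Z \<omega>"
      unfolding em Z_def T_def using e1 pos(1) by (simp add: field_simps)
    finally have "exp (T * (norm (u - \<gamma> *\<^sub>R clip (X \<omega>) lam))\<^sup>2) \<le> exp (2 * L / r\<^sup>2 * (norm u)\<^sup>2) * exp (Z \<omega>)"
      by (simp add: exp_add[symmetric])
    also have "\<dots> \<le> exp (2 * L / r\<^sup>2 * (norm u)\<^sup>2) * (1 + Z \<omega> + (Z \<omega>)\<^sup>2)"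
      using Z1[of \<omega>] by (intro mult_left_mono exp_le_quadratic) auto
    finally show ?thesis by (simp add: T_def e_def)
  qed
  have "(\<integral>\<^sup>+ \<omega>. ennreal (exp (2 * L * exp (\<gamma> * \<mu>) / r\<^sup>2 * (norm (u - \<gamma> *\<^sub>R clip (X \<omega>) lam))\<^sup>2)) \<partial>M)
    \<le> (\<integral>\<^sup>+ \<omega>. ennreal (exp (2 * L / r\<^sup>2 * (norm u)\<^sup>2) * (1 + Z \<omega> + (Z \<omega>)\<^sup>2)) \<partial>M)"
    by (intro nn_integral_mono ennreal_leI pt)
  also have "\<dots> = ennreal (expectation (\<lambda>\<omega>. exp (2 * L / r\<^sup>2 * (norm u)\<^sup>2) * (1 + Z \<omega> + (Z \<omega>)\<^sup>2)))"
  proof (rule nn_integral_eq_integral)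
    show "integrable M (\<lambda>\<omega>. exp (2 * L / r\<^sup>2 * (norm u)\<^sup>2) * (1 + Z \<omega> + (Z \<omega>)\<^sup>2))"
      using Zint Z2int by auto
    show "AE \<omega> in M. 0 \<le> exp (2 * L / r\<^sup>2 * (norm u)\<^sup>2) * (1 + Z \<omega> + (Z \<omega>)\<^sup>2)"
      using Z1 by (intro AE_I2 mult_nonneg_nonneg) (auto simp: abs_le_iff add_nonneg_nonneg, smt (verit) Z1 zero_le_power2)
  qed
  also have "\<dots> = ennreal (exp (2 * L / r\<^sup>2 * (norm u)\<^sup>2) * expectation (\<lambda>\<omega>. 1 + Z \<omega> + (Z \<omega>)\<^sup>2))"
    by simp
  also have "\<dots> \<le> ennreal (exp (2 * L / r\<^sup>2 * (norm u)\<^sup>2) * exp (L / (50 * N)))"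
    using fin by (intro ennreal_leI mult_left_mono) auto
  finally show ?thesis by (simp add: mult.commute)
qed

end

subsection \<open>Independent samples and minibatches\<close>

text \<open>Fubini on the joint law, which independence makes a product. This takes the place of
  conditioning on the past: a bound shown for every fixed past is integrated over the law of the
  past.\<close>

lemma (in prob_space) nn_integral_indep_var_le:
  assumes ind: "indep_var S X T Y"
    and f[measurable]: "f \<in> borel_measurable (S \<Otimes>\<^sub>M T)" and g[measurable]: "g \<in> borel_measurable S"
    and le: "\<And>x. x \<in> space S \<Longrightarrow> (\<integral>\<^sup>+ \<omega>. f (x, Y \<omega>) \<partial>M) \<le> g x"
  shows "(\<integral>\<^sup>+ \<omega>. f (X \<omega>, Y \<omega>) \<partial>M) \<le> (\<integral>\<^sup>+ \<omega>. g (X \<omega>) \<partial>M)"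
proof -
  have [measurable]: "X \<in> measurable M S" "Y \<in> measurable M T"
    and eq: "distr M S X \<Otimes>\<^sub>M distr M T Y = distr M (S \<Otimes>\<^sub>M T) (\<lambda>x. (X x, Y x))"
    using ind unfolding indep_var_distribution_eq by blast+
  interpret X: prob_space "distr M S X" by (rule prob_space_distr) simp
  interpret Y: prob_space "distr M T Y" by (rule prob_space_distr) simp
  have "(\<integral>\<^sup>+ \<omega>. f (X \<omega>, Y \<omega>) \<partial>M) = (\<integral>\<^sup>+ z. f z \<partial>(distr M S X \<Otimes>\<^sub>M distr M T Y))"
    unfolding eq by (subst nn_integral_distr) simp_all
  also have "\<dots> = (\<integral>\<^sup>+ x. \<integral>\<^sup>+ y. f (x, y) \<partial>distr M T Y \<partial>distr M S X)"
    by (rule Y.nn_integral_fst[symmetric]) simp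
  also have "\<dots> \<le> (\<integral>\<^sup>+ x. g x \<partial>distr M S X)"
  proof (intro nn_integral_mono)
    fix x assume "x \<in> space (distr M S X)"
    then have x [measurable]: "x \<in> space S" by simp
    have "(\<integral>\<^sup>+ y. f (x, y) \<partial>distr M T Y) = (\<integral>\<^sup>+ \<omega>. f (x, Y \<omega>) \<partial>M)"
      by (subst nn_integral_distr) simp_all
    then show "(\<integral>\<^sup>+ y. f (x, y) \<partial>distr M T Y) \<le> g x" using le[OF x] by simp
  qed
  also have "\<dots> = (\<integral>\<^sup>+ \<omega>. g (X \<omega>) \<partial>M)" by (subst nn_integral_distr) simp_all
  finally show ?thesis .
qed

text \<open>Coordinatewise this is the product rule for independent real variables. It removes the
  off-diagonal terms of the minibatch variance.\<close>

lemma (in prob_space) expectation_inner_indep_eq_0: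
  fixes X Y :: "'a \<Rightarrow> 'b::euclidean_space"
  assumes ind: "indep_var borel X borel Y"
    and int: "integrable M X" "integrable M Y" and zero: "expectation X = 0"
  shows "integrable M (\<lambda>\<omega>. X \<omega> \<bullet> Y \<omega>)" and "expectation (\<lambda>\<omega>. X \<omega> \<bullet> Y \<omega>) = 0"
proof -
  have ib: "indep_var borel (\<lambda>\<omega>. X \<omega> \<bullet> b) borel (\<lambda>\<omega>. Y \<omega> \<bullet> b)" for b
    using indep_var_compose[OF ind, of "\<lambda>x. x \<bullet> b" borel "\<lambda>x. x \<bullet> b" borel] by (simp add: o_def)
  have int': "integrable M (\<lambda>\<omega>. X \<omega> \<bullet> b)" "integrable M (\<lambda>\<omega>. Y \<omega> \<bullet> b)" for b
    using int by auto
  have prod: "integrable M (\<lambda>\<omega>. (X \<omega> \<bullet> b) * (Y \<omega> \<bullet> b))"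
    "expectation (\<lambda>\<omega>. (X \<omega> \<bullet> b) * (Y \<omega> \<bullet> b)) = 0" for b
    using indep_var_integrable[OF ib int'] indep_var_lebesgue_integral[OF ib int'] int(1) zero
    by simp_all
  have eq: "(\<lambda>\<omega>. X \<omega> \<bullet> Y \<omega>) = (\<lambda>\<omega>. \<Sum>b\<in>Basis. (X \<omega> \<bullet> b) * (Y \<omega> \<bullet> b))"
    by (rule ext) (rule euclidean_inner)
  show "integrable M (\<lambda>\<omega>. X \<omega> \<bullet> Y \<omega>)" "expectation (\<lambda>\<omega>. X \<omega> \<bullet> Y \<omega>) = 0"
    unfolding eq using prod by (auto simp: Bochner_Integration.integral_sum)
qed

text \<open>Adaptedness of the iterates, in a form that allows later samples to be
  discarded.\<close>

lemma clipped_sgda_cong: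
  assumes "\<And>k i. k < t \<Longrightarrow> xi k i = xi' k i"
  shows "clipped_sgda G xi \<gamma> lam m x0 t = clipped_sgda G xi' \<gamma> lam m x0 t"
  using assms by (induction t) (simp_all add: Let_def)

section \<open>Constants of the problem and noise of the oracle\<close>

context clipped_sgda_setting
begin

text \<open>At a point at distance \<open>R\<close> from \<open>xs\<close>, cocoercivity with
  Cauchy-Schwarz gives \<open>norm (F x) \<le> ell * R\<close>, and monotonicity with Cauchy-Schwarz
  gives \<open>\<mu> * R \<le> norm (F x)\<close>. The comparison keeps
  \<open>\<gamma> * \<mu>\<close> small and, for positive \<open>\<mu>\<close>, makes
  \<open>ell / \<mu>\<close> at least 1.\<close>

lemma mu_le_ell: "\<mu> \<le> ell"
proof -
  obtain b :: 'a where b: "b \<in> Basis" using nonempty_Basis by blast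
  define u where "u = R *\<^sub>R b"
  have nu: "norm u = R" using b R_pos by (simp add: u_def)
  define x where "x = xs + u"
  have x: "x \<in> cball xs (2 * R)" "x - xs = u" using nu R_pos by (simp_all add: x_def dist_norm)
  have 1: "\<mu> * R\<^sup>2 \<le> F x \<bullet> u" "(norm (F x))\<^sup>2 \<le> ell * (F x \<bullet> u)"
    using quasi_strongly_monotone[OF x(1)] star_cocoercive[OF x(1)] x(2) nu by simp_all
  have cs: "F x \<bullet> u \<le> norm (F x) * R" using norm_cauchy_schwarz[of "F x" u] nu by simp
  have "norm (F x) \<le> ell * R"
  proof (cases "norm (F x) = 0")
    case False
    have "norm (F x) * norm (F x) \<le> ell * (norm (F x) * R)"
      using 1(2) mult_left_mono[OF cs, of ell] ell_pos unfolding power2_eq_square by linarith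
    then show ?thesis using False by (simp add: mult.left_commute)
  qed (use ell_pos R_pos in auto)
  then have "norm (F x) * R \<le> ell * R * R" using R_pos by (intro mult_right_mono) auto
  then have "\<mu> * R\<^sup>2 \<le> ell * R\<^sup>2" using 1(1) cs by (simp add: power2_eq_square mult.assoc)
  then show ?thesis using R_pos by simp
qed

lemma measurable_sample [measurable]: "\<xi> k i \<in> measurable M D"
proof -
  have "\<forall>p\<in>UNIV. M.random_variable D (case p of (k, i) \<Rightarrow> \<xi> k i)"
    using samples_indep unfolding M.indep_vars_def by blast
  from bspec[OF this, of "(k, i)"] show ?thesis by simp
qed

lemma oracle_measurable [measurable (raw)]:
  assumes "f \<in> measurable N D" "g \<in> borel_measurable N"
  shows "(\<lambda>z. G (f z) (g z)) \<in> borel_measurable N"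
  using measurable_compose[OF measurable_Pair[OF assms] G_measurable] by simp

lemma oracle_noise:
  assumes x: "x \<in> cball xs (2 * R)"
  shows "integrable M (\<lambda>\<omega>. G (\<xi> k i \<omega>) x)"
    and "M.expectation (\<lambda>\<omega>. G (\<xi> k i \<omega>) x) = F x"
    and "integrable M (\<lambda>\<omega>. (norm (G (\<xi> k i \<omega>) x - F x))\<^sup>2)"
    and "M.expectation (\<lambda>\<omega>. (norm (G (\<xi> k i \<omega>) x - F x))\<^sup>2) \<le> \<sigma>\<^sup>2"
proof -
  have [measurable]: "(\<lambda>s. G s x) \<in> borel_measurable D" by measurable
  have "has_bochner_integral (distr M D (\<xi> k i)) (\<lambda>s. G s x) (F x)"
    using F_mean samples_law by simp
  then have int: "integrable (distr M D (\<xi> k i)) (\<lambda>s. G s x)"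
    and mean: "(\<integral>s. G s x \<partial>distr M D (\<xi> k i)) = F x"
    by (auto simp: has_bochner_integral_iff)
  show "integrable M (\<lambda>\<omega>. G (\<xi> k i \<omega>) x)" using int by (subst (asm) integrable_distr_eq) simp_all
  show "M.expectation (\<lambda>\<omega>. G (\<xi> k i \<omega>) x) = F x" using mean by (subst (asm) integral_distr) simp_all
  have "(\<integral>\<^sup>+ \<omega>. ennreal ((norm (G (\<xi> k i \<omega>) x - F x))\<^sup>2) \<partial>M)
      = (\<integral>\<^sup>+ s. ennreal ((norm (G s x - F x))\<^sup>2) \<partial>distr M D (\<xi> k i))"
    by (subst nn_integral_distr) simp_all
  also have "\<dots> \<le> ennreal (\<sigma>\<^sup>2)" using variance_le[OF x] samples_law by simp
  finally have nn: "(\<integral>\<^sup>+ \<omega>. ennreal ((norm (G (\<xi> k i \<omega>) x - F x))\<^sup>2) \<partial>M) \<le> ennreal (\<sigma>\<^sup>2)" .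
  show i: "integrable M (\<lambda>\<omega>. (norm (G (\<xi> k i \<omega>) x - F x))\<^sup>2)"
    by (rule integrableI_nonneg) (use nn in \<open>auto intro: order.strict_trans1\<close>)
  have "ennreal (M.expectation (\<lambda>\<omega>. (norm (G (\<xi> k i \<omega>) x - F x))\<^sup>2)) \<le> ennreal (\<sigma>\<^sup>2)"
    using nn i by (subst (asm) nn_integral_eq_integral) auto
  then show "M.expectation (\<lambda>\<omega>. (norm (G (\<xi> k i \<omega>) x - F x))\<^sup>2) \<le> \<sigma>\<^sup>2" by simp
qed

text \<open>The squared deviation of the mean is a double sum of inner products. Samples within a
  step are pairwise independent and centred, so in expectation only the \<open>n\<close> diagonal
  terms survive the factor \<open>1 / n\<^sup>2\<close>.\<close>

lemma minibatch_noise: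
  fixes n k :: nat
  assumes x: "x \<in> cball xs (2 * R)" and n: "1 \<le> n"
  defines "X \<equiv> \<lambda>\<omega>. (1 / real n) *\<^sub>R (\<Sum>i = 1..n. G (\<xi> k i \<omega>) x)"
  shows "integrable M X" "M.expectation X = F x"
    and "integrable M (\<lambda>\<omega>. (norm (X \<omega> - F x))\<^sup>2)"
    and "M.expectation (\<lambda>\<omega>. (norm (X \<omega> - F x))\<^sup>2) \<le> \<sigma>\<^sup>2 / real n"
proof -
  note noise = oracle_noise[OF x]
  show "integrable M X" unfolding X_def using noise(1) by auto
  show "M.expectation X = F x"
    unfolding X_def using noise(1,2) n
    by (simp add: Bochner_Integration.integral_sum sum_constant_scaleR)
  define U where "U i \<omega> = G (\<xi> k i \<omega>) x - F x" for i \<omega>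
  have Uint: "integrable M (U i)" "M.expectation (U i) = 0" for i
    unfolding U_def using noise(1,2) by (auto simp: M.prob_space)
  have Uind: "M.indep_var borel (U i) borel (U j)" if "i \<noteq> j" for i j
  proof -
    \<comment> \<open>Two singletons serve as disjoint blocks of the sample family; composing with
      evaluation at the single index then removes the product spaces.\<close>
    have "M.indep_var (PiM {(k, i)} (\<lambda>_. D)) (\<lambda>\<omega>. restrict (\<lambda>p. (case p of (k, i) \<Rightarrow> \<xi> k i) \<omega>) {(k, i)})
        (PiM {(k, j)} (\<lambda>_. D)) (\<lambda>\<omega>. restrict (\<lambda>p. (case p of (k, i) \<Rightarrow> \<xi> k i) \<omega>) {(k, j)})"
      using that by (intro M.indep_var_restrict[OF samples_indep]) auto
    then have "M.indep_var borel ((\<lambda>h. G (h (k, i)) x - F x) \<circ> (\<lambda>\<omega>. restrict (\<lambda>p. (case p of (k, i) \<Rightarrow> \<xi> k i) \<omega>) {(k, i)}))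
        borel ((\<lambda>h. G (h (k, j)) x - F x) \<circ> (\<lambda>\<omega>. restrict (\<lambda>p. (case p of (k, i) \<Rightarrow> \<xi> k i) \<omega>) {(k, j)}))"
      by (rule M.indep_var_compose) measurable
    then show ?thesis by (simp add: o_def U_def[abs_def])
  qed
  have UU: "integrable M (\<lambda>\<omega>. U i \<omega> \<bullet> U j \<omega>)"
    "M.expectation (\<lambda>\<omega>. U i \<omega> \<bullet> U j \<omega>) \<le> (if i = j then \<sigma>\<^sup>2 else 0)" for i j
    using noise(3,4)[of k i] M.expectation_inner_indep_eq_0[OF Uind Uint(1) Uint(1) Uint(2), of i j]
    by (cases "i = j"; simp add: U_def power2_norm_eq_inner)+
  have eq: "(norm (X \<omega> - F x))\<^sup>2 = (1 / real n)\<^sup>2 * (\<Sum>i = 1..n. \<Sum>j = 1..n. U i \<omega> \<bullet> U j \<omega>)" for \<omega>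
  proof -
    have "X \<omega> - F x = (1 / real n) *\<^sub>R (\<Sum>i = 1..n. U i \<omega>)"
      using n by (simp add: X_def U_def sum_subtractf sum_constant_scaleR scaleR_diff_right)
    then have "(norm (X \<omega> - F x))\<^sup>2 = (1 / real n)\<^sup>2 * (norm (\<Sum>i = 1..n. U i \<omega>))\<^sup>2"
      by (simp add: power_mult_distrib power_divide)
    also have "(norm (\<Sum>i = 1..n. U i \<omega>))\<^sup>2 = (\<Sum>i = 1..n. \<Sum>j = 1..n. U i \<omega> \<bullet> U j \<omega>)"
      unfolding power2_norm_eq_inner inner_sum_left inner_sum_right by (rule sum.swap)
    finally show ?thesis .
  qed
  show "integrable M (\<lambda>\<omega>. (norm (X \<omega> - F x))\<^sup>2)"
    unfolding eq using UU(1) by auto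
  have "M.expectation (\<lambda>\<omega>. (norm (X \<omega> - F x))\<^sup>2)
      = (1 / real n)\<^sup>2 * (\<Sum>i = 1..n. \<Sum>j = 1..n. M.expectation (\<lambda>\<omega>. U i \<omega> \<bullet> U j \<omega>))"
    unfolding eq using UU(1) by (simp add: Bochner_Integration.integral_sum)
  also have "\<dots> \<le> (1 / real n)\<^sup>2 * (\<Sum>i = 1..n. \<Sum>j = 1..n. (if i = j then \<sigma>\<^sup>2 else 0))"
    by (intro mult_left_mono sum_mono UU) auto
  also have "\<dots> = \<sigma>\<^sup>2 / real n" using n by (simp add: power2_eq_square)
  finally show "M.expectation (\<lambda>\<omega>. (norm (X \<omega> - F x))\<^sup>2) \<le> \<sigma>\<^sup>2 / real n" .
qed

end

subsection \<open>The exponential supermartingale\<close>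

lemma logK_ge_1: "0 < \<beta> \<Longrightarrow> \<beta> \<le> 1 \<Longrightarrow> 1 \<le> logK K \<beta>"
proof -
  assume b: "0 < \<beta>" "\<beta> \<le> 1"
  have "exp 1 \<le> (4::real)" using exp_le by simp
  also have "4 \<le> 4 * (real K + 1) / \<beta>"
    using b by (simp add: pos_le_divide_eq)
  finally show ?thesis using b unfolding logK_def by (subst ln_ge_iff) auto
qed

context clipped_sgda_setting
begin

text \<open>Common to both parameter choices, hence stated for any stepsize and batches with (a) and
  (b). The level \<open>\<epsilon>\<close> is free, so that the same statement yields the rates and
  the complexity claims.\<close>

theorem clipped_sgda_high_probability:
  assumes \<beta>: "0 < \<beta>" "\<beta> \<le> 1" and a: "cond_a ell K \<beta> \<gamma>" and b: "cond_b \<mu> R \<sigma> K \<beta> \<gamma> m"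
    and \<epsilon>: "2 * exp (- (\<gamma> * \<mu> * (real K + 1))) * R\<^sup>2 \<le> \<epsilon>"
  shows "1 - \<beta> \<le> \<P>(\<omega> in M. (norm (sgda_output G \<xi> x0 R \<mu> K \<beta> \<gamma> m \<omega> - xs))\<^sup>2 \<le> \<epsilon>)"
proof -
  define L where "L = logK K \<beta>"
  define N where "N = real K + 1"
  define lam where "lam = clip_level \<gamma> \<mu> R K \<beta>"
  \<comment> \<open>The trajectory becomes a deterministic function of the sample array
    \<open>h\<close>, indexed by pairs as in \<open>samples_indep\<close>. Measurability in the past
    and independence of the next block are then statements about the product spaces
    \<open>S t\<close> and \<open>B t\<close>.\<close>
  define X where "X t h = clipped_sgda G (\<lambda>k i. h (k, i)) \<gamma> lam m x0 t" for t h
  define y where "y t h = exp (\<gamma> * \<mu> * real t) * (norm (X t h - xs))\<^sup>2 / R\<^sup>2" for t h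
  define A where "A t h \<longleftrightarrow> (\<forall>j\<le>t. y j h \<le> 2)" for t h
  define \<Phi> where "\<Phi> t h = ennreal (if A t h then exp (2 * L * y t h) else exp (4 * L))" for t h
  define S where "S t = PiM ({..<t::nat} \<times> (UNIV :: nat set)) (\<lambda>_. D)" for t
  define B where "B t = PiM ({t::nat} \<times> (UNIV :: nat set)) (\<lambda>_. D)" for t
  define h\<omega> where "h\<omega> \<omega> = (\<lambda>p. (case p of (k, i) \<Rightarrow> \<xi> k i) \<omega>)" for \<omega>
  define H where "H t \<omega> = restrict (h\<omega> \<omega>) ({..<t} \<times> UNIV)" for t \<omega>
  define Y where "Y t \<omega> = restrict (h\<omega> \<omega>) ({t} \<times> UNIV)" for t \<omega>
  have L1: "1 \<le> L" using logK_ge_1[OF \<beta>] by (simp add: L_def)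
  have N1: "1 \<le> N" by (simp add: N_def)
  have \<gamma>0: "0 < \<gamma>" "\<gamma> \<le> 1 / (400 * ell * L)" using a by (auto simp: cond_a_def L_def)
  have Xm[measurable]: "X j \<in> borel_measurable (S t)" if "j \<le> t" for j t
    using that
  proof (induction j)
    case (Suc j)
    then have [measurable]: "X j \<in> borel_measurable (S t)" by simp
    have [measurable]: "(\<lambda>h. h (j, i)) \<in> measurable (S t) D" for i
      unfolding S_def using Suc by (intro measurable_component_singleton) auto
    have "(\<lambda>h. X j h - \<gamma> *\<^sub>R clip ((1 / real (m j)) *\<^sub>R (\<Sum>i = 1..m j. G (h (j, i)) (X j h))) (lam j))
        \<in> borel_measurable (S t)"
      by measurable
    then show ?case by (simp add: X_def[abs_def] Let_def)
  qed (simp add: X_def[abs_def])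
  have ym[measurable]: "y j \<in> borel_measurable (S t)" if "j \<le> t" for j t
    unfolding y_def using Xm[OF that] by measurable
  have Am[measurable]: "Measurable.pred (S t) (A t)" for t
    unfolding A_def[abs_def] using ym[of _ t] by measurable
  have \<Phi>m[measurable]: "\<Phi> t \<in> borel_measurable (S t)" for t
    unfolding \<Phi>_def using ym[of t t] by measurable
  \<comment> \<open>The functionals are measurable on the truncated array \<open>H t\<close>, while
    the algorithm runs on the full array \<open>h\<omega>\<close>; these identities connect the
    two.\<close>
  have XH: "X j (H t \<omega>) = X j (h\<omega> \<omega>)" if "j \<le> t" for j t \<omega>
    unfolding X_def H_def using that by (intro clipped_sgda_cong) auto
  have yH: "y j (H t \<omega>) = y j (h\<omega> \<omega>)" if "j \<le> t" for j t \<omega> using XH[OF that] by (simp add: y_def)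
  have AH: "A t (H t \<omega>) = A t (h\<omega> \<omega>)" for t \<omega> using yH by (simp add: A_def)
  have \<Phi>H: "\<Phi> t (H t \<omega>) = \<Phi> t (h\<omega> \<omega>)" for t \<omega> using yH AH by (simp add: \<Phi>_def)
  have ind: "M.indep_var (S t) (H t) (B t) (Y t)" for t
  proof -
    have "M.indep_var (S t) (\<lambda>\<omega>. \<lambda>p\<in>{..<t} \<times> UNIV. (case p of (k, i) \<Rightarrow> \<xi> k i) \<omega>)
      (B t) (\<lambda>\<omega>. \<lambda>p\<in>{t} \<times> UNIV. (case p of (k, i) \<Rightarrow> \<xi> k i) \<omega>)"
      unfolding S_def B_def by (intro M.indep_var_restrict[OF samples_indep]) auto
    then show ?thesis unfolding H_def[abs_def] Y_def[abs_def] h\<omega>_def .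
  qed
  have Hm[measurable]: "H t \<in> measurable M (S t)" for t
    using ind[of t] M.indep_var_rv1 by blast
  have step: "(\<integral>\<^sup>+ \<omega>. \<Phi> (Suc t) (h\<omega> \<omega>) \<partial>M) \<le> ennreal (exp (L / (50 * N))) * (\<integral>\<^sup>+ \<omega>. \<Phi> t (h\<omega> \<omega>) \<partial>M)"
    if t: "t \<le> K" for t
  proof -
    define nxt where "nxt h d = X t h - \<gamma> *\<^sub>R clip ((1 / real (m t)) *\<^sub>R (\<Sum>i = 1..m t. G (d (t, i)) (X t h))) (lam t)"
      for h d
    define f where "f z = ennreal (if A t (fst z)
      then exp (2 * L * (exp (\<gamma> * \<mu> * real (Suc t)) * (norm (nxt (fst z) (snd z) - xs))\<^sup>2 / R\<^sup>2)) else exp (4 * L))" for z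
    define g where "g h = ennreal (exp (L / (50 * N))) * \<Phi> t h" for h
    have [measurable]: "(\<lambda>d. d (t, i)) \<in> measurable (B t) D" for i
      unfolding B_def by (intro measurable_component_singleton) auto
    have [measurable]: "X t \<in> borel_measurable (S t)" using Xm by simp
    have [measurable]: "(\<lambda>z. nxt (fst z) (snd z)) \<in> borel_measurable (S t \<Otimes>\<^sub>M B t)"
      unfolding nxt_def by measurable
    have fm: "f \<in> borel_measurable (S t \<Otimes>\<^sub>M B t)" unfolding f_def by measurable
    have gm: "g \<in> borel_measurable (S t)" unfolding g_def by measurable
    \<comment> \<open>\<open>f\<close> performs the step without testing the new iterate. If
      \<open>y\<close> exceeds 2 for the first time, \<open>f\<close> is at least
      \<open>exp (4 * L)\<close>, the value at which \<open>\<Phi>\<close> is then frozen.\<close>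
    have "\<Phi> (Suc t) (h\<omega> \<omega>) \<le> f (H t \<omega>, Y t \<omega>)" for \<omega>
    proof -
      have "nxt (H t \<omega>) (Y t \<omega>) = X (Suc t) (h\<omega> \<omega>)"
        using XH[of t t \<omega>] by (simp add: nxt_def X_def Let_def Y_def)
      then have feq: "f (H t \<omega>, Y t \<omega>) = ennreal (if A t (h\<omega> \<omega>) then exp (2 * L * y (Suc t) (h\<omega> \<omega>)) else exp (4 * L))"
        by (simp add: f_def AH y_def)
      have ASuc: "A (Suc t) (h\<omega> \<omega>) \<longleftrightarrow> A t (h\<omega> \<omega>) \<and> y (Suc t) (h\<omega> \<omega>) \<le> 2"
        by (auto simp: A_def le_Suc_eq)
      show ?thesis
      proof (cases "A t (h\<omega> \<omega>) \<and> \<not> y (Suc t) (h\<omega> \<omega>) \<le> 2")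
        case True
        then have "4 * L \<le> 2 * L * y (Suc t) (h\<omega> \<omega>)"
          using mult_left_mono[of 2 "y (Suc t) (h\<omega> \<omega>)" "2 * L"] L1 by simp
        then show ?thesis using True ASuc by (auto simp: feq \<Phi>_def intro!: ennreal_leI)
      next
        case False
        then show ?thesis using ASuc by (auto simp: feq \<Phi>_def)
      qed
    qed
    then have "(\<integral>\<^sup>+ \<omega>. \<Phi> (Suc t) (h\<omega> \<omega>) \<partial>M) \<le> (\<integral>\<^sup>+ \<omega>. f (H t \<omega>, Y t \<omega>) \<partial>M)"
      by (intro nn_integral_mono) auto
    also have "\<dots> \<le> (\<integral>\<^sup>+ \<omega>. g (H t \<omega>) \<partial>M)"
    proof (rule M.nn_integral_indep_var_le[OF ind fm gm])
      fix h assume "h \<in> space (S t)"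
      show "(\<integral>\<^sup>+ \<omega>. f (h, Y t \<omega>) \<partial>M) \<le> g h"
      proof (cases "A t h")
        case False
        have "1 \<le> exp (L / (50 * N))" using L1 N1 by simp
        then have "exp (4 * L) \<le> exp (L / (50 * N)) * exp (4 * L)" by simp
        then show ?thesis using False
          by (simp add: f_def g_def \<Phi>_def ennreal_mult[symmetric] M.emeasure_space_1 ennreal_leI del: exp_le_cancel_iff)
      next
        case True
        define x where "x = X t h"
        define r where "r = exp (- (\<gamma> * \<mu> * real t) / 2) * R"
        have r0: "0 < r" using R_pos by (simp add: r_def)
        have r2: "r\<^sup>2 = exp (- (\<gamma> * \<mu> * real t)) * R\<^sup>2"
          by (simp add: r_def power_mult_distrib exp_double[symmetric])
        have yr: "y t h = (norm (x - xs))\<^sup>2 / r\<^sup>2"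
          unfolding y_def x_def r2 exp_minus using R_pos by (simp add: field_simps)
        have "y t h \<le> 2" using True by (simp add: A_def)
        then have u: "(norm (x - xs))\<^sup>2 \<le> 2 * r\<^sup>2" unfolding yr using r0 by (simp add: field_simps)
        \<comment> \<open>As \<open>r \<le> R\<close>, the event \<open>A t h\<close> puts
          \<open>x\<close> within \<open>sqrt 2 * R\<close> of \<open>xs\<close>, inside the ball
          where the assumptions hold.\<close>
        have "r\<^sup>2 \<le> 1 * R\<^sup>2" unfolding r2 using mu_nonneg \<gamma>0 by (intro mult_right_mono) auto
        then have "(norm (x - xs))\<^sup>2 \<le> 4 * R\<^sup>2" using u zero_le_power2[of R] by linarith
        then have "(norm (x - xs))\<^sup>2 \<le> (2 * R)\<^sup>2" by (simp add: power_mult_distrib)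
        then have "norm (x - xs) \<le> 2 * R" by (rule power2_le_imp_le) (use R_pos in simp)
        then have xQ: "x \<in> cball xs (2 * R)" by (simp add: dist_norm norm_minus_commute)
        have mb: "batch_bound \<gamma> \<mu> R \<sigma> K \<beta> t \<le> real (m t)" using b t by (simp add: cond_b_def)
        then have m1: "1 \<le> m t" by (simp add: batch_bound_def)
        have "27000 * \<gamma>\<^sup>2 * N * \<sigma>\<^sup>2 * L / r\<^sup>2 \<le> real (m t)"
          using mb by (simp add: batch_bound_def r2 N_def L_def)
        then have V: "\<sigma>\<^sup>2 / real (m t) \<le> r\<^sup>2 / (27000 * \<gamma>\<^sup>2 * N * L)"
          using r0 m1 \<gamma>0 N1 L1 by (simp add: field_simps)
        \<comment> \<open>The \<open>k / 2\<close> in the clipping level is the decay of the radius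
          \<open>r\<close>, the square root of the decay of the squared distance; the
          \<open>1\<close> is the factor \<open>exp (- (\<gamma> * \<mu>))\<close>.\<close>
        have lamt: "lam t = exp (- (\<gamma> * \<mu>)) * r / (120 * \<gamma> * L)"
          unfolding lam_def clip_level_def r_def L_def
          by (simp add: exp_add[symmetric] algebra_simps mult_exp_exp)
        define Z where "Z \<omega> = (1 / real (m t)) *\<^sub>R (\<Sum>i = 1..m t. G (\<xi> t i \<omega>) x)" for \<omega>
        note mbn = minibatch_noise[OF xQ m1, of t, folded Z_def]
        have "(\<integral>\<^sup>+ \<omega>. f (h, Y t \<omega>) \<partial>M)
          = (\<integral>\<^sup>+ \<omega>. ennreal (exp (2 * L * exp (\<gamma> * \<mu>) / r\<^sup>2 * (norm ((x - xs) - \<gamma> *\<^sub>R clip (Z \<omega>) (lam t)))\<^sup>2)) \<partial>M)"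
        proof (intro nn_integral_cong)
          fix \<omega>
          have "nxt h (Y t \<omega>) - xs = (x - xs) - \<gamma> *\<^sub>R clip (Z \<omega>) (lam t)"
            by (simp add: nxt_def x_def Z_def Y_def h\<omega>_def)
          moreover have "2 * L * (exp (\<gamma> * \<mu> * real (Suc t)) * c / R\<^sup>2) = 2 * L * exp (\<gamma> * \<mu>) / r\<^sup>2 * c" for c
          proof -
            have "exp (\<gamma> * \<mu> * real (Suc t)) = exp (\<gamma> * \<mu>) * exp (\<gamma> * \<mu> * real t)"
              by (simp add: exp_add[symmetric] algebra_simps)
            then show ?thesis unfolding r2 exp_minus using R_pos by (simp add: field_simps)
          qed
          ultimately show "f (h, Y t \<omega>) = ennreal (exp (2 * L * exp (\<gamma> * \<mu>) / r\<^sup>2 * (norm ((x - xs) - \<gamma> *\<^sub>R clip (Z \<omega>) (lam t)))\<^sup>2))"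
            using True unfolding f_def by (simp only: fst_conv snd_conv if_True)
        qed
        also have "\<dots> \<le> ennreal (exp (L / (50 * N)) * exp (2 * L / r\<^sup>2 * (norm (x - xs))\<^sup>2))"
          using r0 \<gamma>0 L1 N1
          by (intro M.expectation_exp_step_le[OF _ _ _ _ V, where ell = ell and f = "F x"] mbn mu_nonneg mu_le_ell ell_pos u
              quasi_strongly_monotone[OF xQ] star_cocoercive[OF xQ] lamt) auto
        also have "\<dots> = g h" using True
          by (simp add: g_def \<Phi>_def yr ennreal_mult)
        finally show ?thesis .
      qed
    qed
    also have "\<dots> = (\<integral>\<^sup>+ \<omega>. ennreal (exp (L / (50 * N))) * \<Phi> t (H t \<omega>) \<partial>M)"
      by (simp add: g_def)
    also have "\<dots> = ennreal (exp (L / (50 * N))) * (\<integral>\<^sup>+ \<omega>. \<Phi> t (H t \<omega>) \<partial>M)"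
      by (intro nn_integral_cmult) measurable
    finally show ?thesis by (simp add: \<Phi>H)
  qed
  have y0: "y 0 h \<le> 1" for h
    using R_ge R_pos by (auto simp: y_def X_def divide_simps intro!: power_mono)
  have bound: "(\<integral>\<^sup>+ \<omega>. \<Phi> t (h\<omega> \<omega>) \<partial>M) \<le> ennreal (exp (L / (50 * N)) ^ t * exp (2 * L))" if "t \<le> K + 1" for t
    using that
  proof (induction t)
    case 0
    have "A 0 h" for h using y0[of h] by (simp add: A_def)
    then have "\<Phi> 0 h \<le> ennreal (exp (2 * L))" for h
      using y0[of h] L1 by (auto simp: \<Phi>_def intro!: ennreal_leI)
    then have "(\<integral>\<^sup>+ \<omega>. \<Phi> 0 (h\<omega> \<omega>) \<partial>M) \<le> (\<integral>\<^sup>+ \<omega>. ennreal (exp (2 * L)) \<partial>M)"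
      by (intro nn_integral_mono) auto
    then show ?case by (simp add: M.emeasure_space_1)
  next
    case (Suc t)
    then have "(\<integral>\<^sup>+ \<omega>. \<Phi> (Suc t) (h\<omega> \<omega>) \<partial>M)
      \<le> ennreal (exp (L / (50 * N))) * ennreal (exp (L / (50 * N)) ^ t * exp (2 * L))"
      by (intro order_trans[OF step] mult_left_mono) auto
    then show ?case by (simp add: ennreal_mult[symmetric] mult.assoc)
  qed
  define bad where "bad = {\<omega> \<in> space M. \<not> A (K + 1) (H (K + 1) \<omega>)}"
  have bad[measurable]: "bad \<in> sets M" unfolding bad_def by measurable
  \<comment> \<open>Markov's inequality, as \<open>\<Phi>\<close> equals \<open>exp (4 * L)\<close>
    on \<open>bad\<close>.\<close>
  have "ennreal (exp (4 * L)) * emeasure M bad = (\<integral>\<^sup>+ \<omega>. ennreal (exp (4 * L)) * indicator bad \<omega> \<partial>M)"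
    by (rule nn_integral_cmult_indicator[symmetric]) (rule bad)
  also have "\<dots> \<le> (\<integral>\<^sup>+ \<omega>. \<Phi> (K + 1) (h\<omega> \<omega>) \<partial>M)"
    by (intro nn_integral_mono) (auto simp: bad_def AH \<Phi>_def indicator_def)
  also have "\<dots> \<le> ennreal (exp (L / (50 * N)) ^ (K + 1) * exp (2 * L))" by (rule bound) simp
  also have "exp (L / (50 * N)) ^ (K + 1) = exp (L / 50)"
  proof -
    have "real (K + 1) * (L / (50 * N)) = L / 50" using N1 unfolding N_def by (simp add: field_simps)
    then show ?thesis by (metis exp_of_nat_mult)
  qed
  finally have "exp (4 * L) * M.prob bad \<le> exp (L / 50) * exp (2 * L)"
    by (simp add: M.emeasure_eq_measure ennreal_mult[symmetric])
  also have "\<dots> \<le> exp (4 * L) * exp (- L)" using L1 by (simp add: exp_add[symmetric])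
  finally have "M.prob bad \<le> exp (- L)" by simp
  also have "\<dots> \<le> \<beta>"
  proof -
    have "exp (- L) = \<beta> / (4 * N)"
      unfolding L_def logK_def N_def exp_minus using \<beta> by (simp add: inverse_eq_divide)
    also have "\<dots> \<le> \<beta> / 1" using \<beta> N1 by (intro divide_left_mono) auto
    finally show ?thesis by simp
  qed
  finally have pb: "M.prob bad \<le> \<beta>" .
  define good where "good = {\<omega> \<in> space M. (norm (sgda_output G \<xi> x0 R \<mu> K \<beta> \<gamma> m \<omega> - xs))\<^sup>2 \<le> \<epsilon>}"
  have out: "sgda_output G \<xi> x0 R \<mu> K \<beta> \<gamma> m \<omega> = X (K + 1) (H (K + 1) \<omega>)" for \<omega>
    using XH[of "K + 1" "K + 1" \<omega>] by (simp add: sgda_output_def X_def lam_def h\<omega>_def)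
  have XKm: "X (K + 1) \<in> borel_measurable (S (K + 1))" by (rule Xm) simp
  have good[measurable]: "good \<in> sets M"
    unfolding good_def out using measurable_compose[OF Hm XKm] by measurable
  have "space M - bad \<subseteq> good"
  proof
    fix \<omega> assume "\<omega> \<in> space M - bad"
    then have \<omega>: "\<omega> \<in> space M" and "y (K + 1) (H (K + 1) \<omega>) \<le> 2" by (auto simp: bad_def A_def)
    then have "(norm (X (K + 1) (H (K + 1) \<omega>) - xs))\<^sup>2 \<le> 2 * exp (- (\<gamma> * \<mu> * (real K + 1))) * R\<^sup>2"
      unfolding y_def exp_minus using R_pos by (simp add: field_simps)
    then show "\<omega> \<in> good" using \<omega> \<epsilon> by (simp add: good_def out)
  qed
  then have "M.prob (space M - bad) \<le> M.prob good" by (intro M.finite_measure_mono good)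
  then have "1 - \<beta> \<le> M.prob good" using M.prob_compl[OF bad] pb by simp
  then show ?thesis by (simp add: good_def)
qed

end

subsection \<open>Horizons and complexity\<close>

text \<open>The right-hand side sends 2 to \<open>b\<close>, and being antitone it sends
  \<open>b\<close> to at most \<open>b\<close>. The intermediate value theorem gives a fixed point
  in between.\<close>

lemma implicit_max_unique:
  fixes A :: real
  assumes A: "0 < A"
  shows "\<exists>!B. B = max 2 (A / (ln B)\<^sup>2)"
proof (rule ex_ex1I)
  define g where "g B = B - max 2 (A / (ln B)\<^sup>2)" for B
  define b where "b = max 2 (A / (ln 2)\<^sup>2)"
  have ln2: "0 < ln (2::real)" by simp
  have anti: "A / (ln y)\<^sup>2 \<le> A / (ln x)\<^sup>2" if "2 \<le> x" "x \<le> y" for x y :: real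
    using that A by (intro divide_left_mono power_mono zero_less_power mult_pos_pos) auto
  have "A / (ln b)\<^sup>2 \<le> A / (ln 2)\<^sup>2" by (rule anti) (auto simp: b_def)
  then have "0 \<le> g b" by (auto simp: g_def b_def)
  moreover have "g 2 \<le> 0" by (auto simp: g_def)
  moreover have "continuous_on {2..b} g"
    unfolding g_def by (intro continuous_intros) auto
  ultimately obtain B where "g B = 0"
    using IVT'[of g 2 0 b] by (auto simp: b_def)
  then show "\<exists>B. B = max 2 (A / (ln B)\<^sup>2)" by (auto simp: g_def)
  have le: "y \<le> x" if "x = max 2 (A / (ln x)\<^sup>2)" "y = max 2 (A / (ln y)\<^sup>2)" for x y
  proof (rule ccontr)
    assume "\<not> y \<le> x"
    moreover have "2 \<le> x" using that(1) by (metis max.cobounded1)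
    ultimately have "A / (ln y)\<^sup>2 \<le> A / (ln x)\<^sup>2" by (intro anti) auto
    then show False using that \<open>\<not> y \<le> x\<close> by (smt (verit))
  qed
  show "x = y" if "x = max 2 (A / (ln x)\<^sup>2)" "y = max 2 (A / (ln y)\<^sup>2)" for x y
    using le[OF that] le[OF that(2,1)] by simp
qed

text \<open>On the branch \<open>B > 2\<close> one has
  \<open>A = B * (ln B)\<^sup>2 \<le> B ^ 3\<close>, so \<open>ln (max 2 A) \<le> 3 * ln B\<close>;
  the 9 is the square of this 3.\<close>

lemma implicit_max_le:
  fixes A B :: real
  assumes A: "0 < A" and B: "B = max 2 (A / (ln B)\<^sup>2)"
  shows "B \<le> 9 * max 2 (A / (ln (max 2 A))\<^sup>2)"
proof (cases "2 < B")
  case True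
  then have eq: "B = A / (ln B)\<^sup>2" using B by (auto simp: max_def split: if_splits)
  have lnB: "0 < ln B" using True by simp
  have Aeq: "A = B * (ln B)\<^sup>2" using eq lnB by (metis less_irrefl nonzero_eq_divide_eq power_eq_0_iff)
  have lnB_le: "ln B \<le> B" using ln_le_minus_one[of B] True by simp
  have "A \<le> B * B\<^sup>2" unfolding Aeq using lnB lnB_le True by (intro mult_left_mono power_mono) auto
  moreover have "B * 1 \<le> B * B\<^sup>2" using True by (intro mult_left_mono) auto
  ultimately have "max 2 A \<le> B * B\<^sup>2" using True by linarith
  then have "max 2 A \<le> B ^ 3" by (simp add: power3_eq_cube power2_eq_square)
  then have "ln (max 2 A) \<le> ln (B ^ 3)" by (intro ln_mono) auto
  also have "\<dots> = 3 * ln B" using True by (simp add: ln_realpow)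
  finally have ln3: "ln (max 2 A) \<le> 3 * ln B" .
  have l0: "0 < ln (max 2 A)" by (simp add: max_def)
  have "(ln (max 2 A))\<^sup>2 \<le> (3 * ln B)\<^sup>2" using ln3 l0 by (intro power_mono) auto
  then have "A / (3 * ln B)\<^sup>2 \<le> A / (ln (max 2 A))\<^sup>2" using A l0 lnB by (intro divide_left_mono) auto
  then have "A / (ln B)\<^sup>2 \<le> 9 * (A / (ln (max 2 A))\<^sup>2)" by (simp add: power_mult_distrib)
  then show ?thesis using eq by (simp add: max_def)
qed (use B in linarith)

lemma B_K_eq:
  assumes "0 < B_arg \<mu> R \<sigma> K \<beta>"
  shows "B_K \<mu> R \<sigma> K \<beta> = max 2 (B_arg \<mu> R \<sigma> K \<beta> / (ln (B_K \<mu> R \<sigma> K \<beta>))\<^sup>2)"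
  unfolding B_K_def by (rule theI'[OF implicit_max_unique[OF assms]])

text \<open>For \<open>r = R\<^sup>2 / \<epsilon>\<close> this allows \<open>ln r\<close> to be
  traded for \<open>ln B_eps\<close> in the complexity bound. Two losses occur:
  \<open>w\<^sup>2 \<le> r\<close> gives \<open>ln r \<le> 2 * ln (r / w)\<close>, and dividing by a
  squared logarithm costs at most half of the remaining exponent up to a constant.\<close>

lemma ln_B_eps_ge:
  fixes r w :: real
  assumes "1 \<le> ln r" "0 < r" "1 \<le> w" "w\<^sup>2 \<le> r"
  shows "ln r / 20 \<le> ln (max 2 (r / w / (ln (max 2 (r / w)))\<^sup>2))"
proof -
  define q where "q = r / w"
  define z where "z = max 2 q"
  define b where "b = max 2 (q / (ln z)\<^sup>2)"
  define v where "v = ln z"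
  have q0: "0 < q" using assms by (simp add: q_def)
  have "r * w\<^sup>2 \<le> r * r" using assms by (intro mult_left_mono) auto
  then have "r \<le> q\<^sup>2" using assms by (simp add: q_def field_simps power2_eq_square)
  then have "ln r \<le> ln (q\<^sup>2)" using assms by (intro ln_mono) auto
  then have "ln r \<le> 2 * ln q" using q0 by (simp add: ln_realpow)
  also have "\<dots> \<le> 2 * v" unfolding v_def using q0 by (simp add: z_def)
  finally have rv: "ln r \<le> 2 * v" .
  have v0: "0 < v" by (simp add: v_def z_def max_def)
  have b2: "2 \<le> b" by (simp add: b_def)
  have lnb: "ln 2 \<le> ln b" using b2 by (intro ln_mono) auto
  have "v \<le> 10 * ln b"
  proof (cases "q \<le> 2")
    case True
    then have "z = 2" by (simp add: z_def)
    then show ?thesis using lnb ln2_ge_two_thirds by (simp add: v_def)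
  next
    case False
    then have zq: "z = q" "0 < z" by (simp_all add: z_def)
    have "v / 4 \<le> exp (v / 4)" using exp_ge_add_one_self[of "v / 4"] by linarith
    then have "(v / 4)\<^sup>2 \<le> (exp (v / 4))\<^sup>2" using v0 by (intro power_mono) auto
    also have "\<dots> = exp (v / 2)" by (simp add: exp_double[symmetric])
    finally have "v\<^sup>2 \<le> 16 * exp (v / 2)" by (simp add: power_divide)
    then have "exp (v / 2) * v\<^sup>2 \<le> exp (v / 2) * (16 * exp (v / 2))" by (intro mult_left_mono) auto
    also have "\<dots> = 16 * z" using zq by (simp add: exp_add[symmetric] v_def)
    finally have "exp (v / 2) \<le> 16 * (q / v\<^sup>2)" using v0 by (simp add: zq(1) field_simps)
    then have "exp (v / 2) \<le> 16 * (q / (ln z)\<^sup>2)" by (simp only: v_def)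
    also have "\<dots> \<le> 16 * b" by (simp add: b_def)
    finally have "ln (exp (v / 2)) \<le> ln (2 ^ 4 * b)" using b2 by (intro ln_mono) auto
    also have "\<dots> = 4 * ln 2 + ln b" using b2 ln_mult[of "2 ^ 4" b] ln_realpow[of 2 4] by simp
    \<comment> \<open>As \<open>b \<ge> 2\<close>, one gets
      \<open>v / 2 \<le> 4 * ln 2 + ln b \<le> 5 * ln b\<close>.\<close>
    finally show ?thesis using lnb by simp
  qed
  then show ?thesis using rv by (simp add: b_def z_def q_def)
qed

text \<open>A horizon of order \<open>P q\<close> suffices for \<open>(K + 1) / ln (4 (K + 1) / \<beta>)\<close> to be of order \<open>P\<close>:
  that logarithm is of order \<open>q\<close>.\<close>

lemma horizon_exists:
  fixes P q \<beta> :: real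
  assumes P: "1 \<le> P" and q: "1 \<le> q" and \<beta>: "0 < \<beta>" and ln: "ln (P * q / \<beta>) \<le> 4 * q"
  obtains K where "real K + 1 \<le> 8000000 * (P * q)" "216000 * P * logK K \<beta> \<le> real K + 1"
proof
  \<comment> \<open>7000000 exceeds \<open>216000 * 29\<close>, where \<open>29 * q\<close> bounds
    the logarithm: \<open>2 ^ 25\<close> covers \<open>4 * 7000001\<close>, so it contributes at
    most 25, and \<open>4 * q\<close> comes from the hypothesis.\<close>
  define x where "x = 7000000 * (P * q)"
  define K where "K = nat \<lceil>x\<rceil> - 1"
  have "1 * 1 \<le> P * q" using P q by (intro mult_mono) auto
  then have Pq: "1 \<le> P * q" by simp
  have x1: "1 \<le> x" using Pq by (simp add: x_def)
  have "0 < \<lceil>x\<rceil>" using x1 by simp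
  then have "K + 1 = nat \<lceil>x\<rceil>" unfolding K_def by linarith
  then have K: "real K + 1 = of_int \<lceil>x\<rceil>" using \<open>0 < \<lceil>x\<rceil>\<close> by (metis int_nat_eq less_imp_le of_int_of_nat_eq of_nat_1 of_nat_add)
  have K_ge: "x \<le> real K + 1" unfolding K by (rule le_of_int_ceiling)
  have "real K + 1 \<le> x + 1" unfolding K by (rule of_int_ceiling_le_add_one)
  then have K_le: "real K + 1 \<le> 7000001 * (P * q)" using Pq unfolding x_def by linarith
  then show "real K + 1 \<le> 8000000 * (P * q)" using Pq by linarith
  have "4 * (real K + 1) / \<beta> \<le> 4 * (7000001 * (P * q)) / \<beta>"
    using K_le \<beta> by (intro divide_right_mono) auto
  also have "\<dots> \<le> 2 ^ 25 * (P * q / \<beta>)" using Pq \<beta> by (simp add: field_simps)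
  finally have "logK K \<beta> \<le> ln (2 ^ 25 * (P * q / \<beta>))"
    unfolding logK_def using \<beta> by (intro ln_mono) auto
  also have "\<dots> = 25 * ln 2 + ln (P * q / \<beta>)"
    using ln_mult[of "2 ^ 25" "P * q / \<beta>"] ln_realpow[of 2 25] Pq \<beta> P q by simp
  also have "\<dots> \<le> 25 + 4 * q" using ln ln_2_less_1 by simp
  also have "\<dots> \<le> 29 * q" using q by simp
  finally have "216000 * P * logK K \<beta> \<le> 216000 * P * (29 * q)" using P by (intro mult_left_mono) auto
  also have "\<dots> \<le> x" using Pq by (simp add: x_def)
  finally show "216000 * P * logK K \<beta> \<le> real K + 1" using K_ge by linarith
qed

text \<open>Comparison with the integral of \<open>exp (p * x)\<close> from 0 to
  \<open>K + 1\<close>; discretely it rests on \<open>1 + p \<le> exp p\<close>. With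
  \<open>p = \<gamma> * \<mu>\<close> it sums the growing batches.\<close>

lemma sum_exp_le:
  fixes p :: real
  assumes "0 < p"
  shows "(\<Sum>k = 0..K. exp (p * real k)) \<le> exp (p * (real K + 1)) / p"
proof (induction K)
  case 0
  have "p \<le> exp p" using exp_ge_add_one_self[of p] by linarith
  then show ?case using assms by (simp add: field_simps)
next
  case (Suc K)
  have "(\<Sum>k = 0..Suc K. exp (p * real k)) \<le> exp (p * (real K + 1)) / p + exp (p * (real K + 1))"
    using Suc by (simp add: add.commute)
  also have "\<dots> = exp (p * (real K + 1)) * (1 + p) / p" using assms by (simp add: field_simps)
  also have "\<dots> \<le> exp (p * (real K + 1)) * exp p / p"
    using assms by (intro divide_right_mono mult_left_mono) auto
  also have "exp (p * (real K + 1)) * exp p = exp (p * (real (Suc K) + 1))"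
    by (simp add: exp_add[symmetric] algebra_simps)
  finally show ?case .
qed

section \<open>Horizons at which the rates reach the accuracy\<close>

lemma rate_large_le_of_horizon:
  fixes \<mu> ell R \<epsilon> \<beta> :: real
  assumes pos: "0 < \<mu>" "0 < ell" "0 < R" "0 < \<epsilon>" "0 < logK K \<beta>" and \<Lambda>: "1 \<le> ln (R\<^sup>2 / \<epsilon>)"
    and n: "800 * (ell / \<mu> * ln (R\<^sup>2 / \<epsilon>)) * logK K \<beta> \<le> real K + 1"
  shows "rate_large \<mu> ell R K \<beta> \<le> \<epsilon>"
proof -
  define l where "l = ln (R\<^sup>2 / \<epsilon>)"
  have "800 * (ell * l) * logK K \<beta> \<le> \<mu> * (real K + 1)"
    using n pos unfolding l_def[symmetric] by (simp add: field_simps)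
  then have "2 * l \<le> \<mu> * (real K + 1) / (400 * ell * logK K \<beta>)"
    using pos by (simp add: field_simps)
  then have "exp (- (\<mu> * (real K + 1) / (400 * ell * logK K \<beta>))) \<le> exp (- (2 * l))" by simp
  \<comment> \<open>The 800 is twice the 400 of the stepsize: one factor \<open>exp (- l)\<close>
    gives \<open>\<epsilon> / R\<^sup>2\<close>, the other absorbs the 2 in front of the
    rate.\<close>
  also have "\<dots> = exp (- l) * exp (- l)" by (simp add: exp_add[symmetric])
  also have "\<dots> \<le> exp (- 1) * (\<epsilon> / R\<^sup>2)"
  proof (intro mult_mono)
    show "exp (- l) \<le> exp (- 1)" using \<Lambda> by (simp add: l_def)
    show "exp (- l) \<le> \<epsilon> / R\<^sup>2" using pos by (simp add: l_def exp_minus)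
  qed auto
  also have "\<dots> \<le> 1 / 2 * (\<epsilon> / R\<^sup>2)"
  proof -
    have "2 \<le> exp (1::real)" using exp_ge_add_one_self[of 1] by simp
    then have "exp (- 1) \<le> (1 / 2 :: real)" unfolding exp_minus by (simp add: field_simps)
    then show ?thesis using pos by (intro mult_right_mono) auto
  qed
  finally show ?thesis using pos unfolding rate_large_def by (simp add: field_simps)
qed

text \<open>If \<open>B < \<rho>\<close>, antitonicity would give \<open>B \<ge> A / (ln B)\<^sup>2
  \<ge> A / (ln \<rho>)\<^sup>2 \<ge> \<rho>\<close>. So \<open>B \<ge> \<rho> > 2\<close>, the
  maximum is attained by its second argument, and there the noise term equals
  \<open>2 * R\<^sup>2 / B \<le> 2 * R\<^sup>2 / \<rho> = \<epsilon>\<close>. The first claim is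
  what makes unit batches admissible.\<close>

lemma small_noise_le_of_horizon:
  assumes pos: "0 < \<mu>" "0 < \<sigma>" "0 < R" "0 < \<epsilon>" "0 < logK K \<beta>" and \<Lambda>: "1 \<le> ln (R\<^sup>2 / \<epsilon>)"
    and n: "216000 * (\<sigma>\<^sup>2 / (\<mu>\<^sup>2 * \<epsilon>) * (ln (R\<^sup>2 / \<epsilon>))\<^sup>2) * logK K \<beta> \<le> real K + 1"
  defines "B \<equiv> B_K \<mu> R \<sigma> K \<beta>"
  shows "2 \<le> B_arg \<mu> R \<sigma> K \<beta> / (ln B)\<^sup>2"
    and "54000 * \<sigma>\<^sup>2 * logK K \<beta> * (ln B)\<^sup>2 / (\<mu>\<^sup>2 * (real K + 1)) \<le> \<epsilon>"
proof -
  define L where "L = logK K \<beta>"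
  define A where "A = B_arg \<mu> R \<sigma> K \<beta>"
  define \<rho> where "\<rho> = 2 * R\<^sup>2 / \<epsilon>"
  define l where "l = ln (R\<^sup>2 / \<epsilon>)"
  have L0: "0 < L" using pos by (simp add: L_def)
  have Aeq: "A * (27000 * \<sigma>\<^sup>2 * L) = (real K + 1) * \<mu>\<^sup>2 * R\<^sup>2"
    using pos by (simp add: A_def B_arg_def L_def)
  have A0: "0 < A" using pos by (simp add: A_def B_arg_def add_pos_nonneg)
  have B: "B = max 2 (A / (ln B)\<^sup>2)" unfolding B_def A_def by (rule B_K_eq) (use A0 in \<open>simp add: A_def\<close>)
  have Beq2: "2 \<le> B" using B by (metis max.cobounded1)
  have R\<epsilon>: "exp 1 \<le> R\<^sup>2 / \<epsilon>" using \<Lambda> pos by (simp add: ln_ge_iff)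
  have "2 \<le> exp (1::real)" using exp_ge_add_one_self[of 1] by simp
  then have \<rho>: "4 \<le> \<rho>" using R\<epsilon> by (simp add: \<rho>_def)
  have "ln \<rho> = ln 2 + l" using ln_mult[of 2 "R\<^sup>2 / \<epsilon>"] pos by (simp add: \<rho>_def l_def)
  then have ln\<rho>: "ln \<rho> \<le> 2 * l" using \<Lambda> ln_2_less_1 by (simp add: l_def)
  have ln\<rho>0: "0 < ln \<rho>" using \<rho> by simp
  have "(ln \<rho>)\<^sup>2 \<le> (2 * l)\<^sup>2" using ln\<rho> ln\<rho>0 by (intro power_mono) auto
  then have "54000 * (\<sigma>\<^sup>2 / (\<mu>\<^sup>2 * \<epsilon>)) * L * (ln \<rho>)\<^sup>2 \<le> 54000 * (\<sigma>\<^sup>2 / (\<mu>\<^sup>2 * \<epsilon>)) * L * (2 * l)\<^sup>2"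
    using pos L0 by (intro mult_left_mono) auto
  \<comment> \<open>216000 is \<open>4 * 54000\<close>, with the 4 from
    \<open>ln \<rho> \<le> 2 * l\<close>.\<close>
  also have "\<dots> \<le> real K + 1" using n by (simp add: l_def L_def mult_ac power_mult_distrib)
  finally have "54000 * (\<sigma>\<^sup>2 / (\<mu>\<^sup>2 * \<epsilon>)) * L * (ln \<rho>)\<^sup>2 * (\<mu>\<^sup>2 * R\<^sup>2) \<le> (real K + 1) * (\<mu>\<^sup>2 * R\<^sup>2)"
    by (intro mult_right_mono) auto
  also have "54000 * (\<sigma>\<^sup>2 / (\<mu>\<^sup>2 * \<epsilon>)) * L * (ln \<rho>)\<^sup>2 * (\<mu>\<^sup>2 * R\<^sup>2) = \<rho> * (ln \<rho>)\<^sup>2 * (27000 * \<sigma>\<^sup>2 * L)"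
    using pos by (simp add: \<rho>_def field_simps)
  also have "(real K + 1) * (\<mu>\<^sup>2 * R\<^sup>2) = A * (27000 * \<sigma>\<^sup>2 * L)" using Aeq by simp
  finally have "\<rho> * (ln \<rho>)\<^sup>2 \<le> A" using pos L0 by simp
  then have A\<rho>: "\<rho> \<le> A / (ln \<rho>)\<^sup>2" using ln\<rho>0 by (simp add: field_simps)
  have \<rho>B: "\<rho> \<le> B"
  proof (rule ccontr)
    assume "\<not> \<rho> \<le> B"
    then have "ln B \<le> ln \<rho>" "0 < ln B" using Beq2 by auto
    then have "A / (ln \<rho>)\<^sup>2 \<le> A / (ln B)\<^sup>2" using A0 ln\<rho>0 by (intro divide_left_mono power_mono) auto
    then have "\<rho> \<le> B" using A\<rho> B by linarith
    then show False using \<open>\<not> \<rho> \<le> B\<close> by simp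
  qed
  then have Beq: "B = A / (ln B)\<^sup>2" using B \<rho> by (auto simp: max_def split: if_splits)
  then show "2 \<le> B_arg \<mu> R \<sigma> K \<beta> / (ln B)\<^sup>2" using Beq2 by (simp add: A_def)
  have lnB: "0 < ln B" using Beq2 by simp
  have "\<rho> * (ln B)\<^sup>2 \<le> B * (ln B)\<^sup>2" using \<rho>B by (intro mult_right_mono) auto
  also have "B * (ln B)\<^sup>2 = A" using Beq lnB by (metis less_irrefl nonzero_eq_divide_eq power_eq_0_iff)
  finally have "\<rho> * (ln B)\<^sup>2 * (27000 * \<sigma>\<^sup>2 * L) \<le> A * (27000 * \<sigma>\<^sup>2 * L)"
    using pos L0 by (intro mult_right_mono) auto
  also have "\<dots> = (real K + 1) * \<mu>\<^sup>2 * R\<^sup>2" by (rule Aeq)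
  also have "\<rho> * (ln B)\<^sup>2 * (27000 * \<sigma>\<^sup>2 * L) = (54000 * \<sigma>\<^sup>2 * L * (ln B)\<^sup>2 / \<epsilon>) * R\<^sup>2"
    by (simp add: \<rho>_def)
  finally have "54000 * \<sigma>\<^sup>2 * L * (ln B)\<^sup>2 / \<epsilon> \<le> (real K + 1) * \<mu>\<^sup>2"
    by (rule mult_right_le_imp_le) (use pos in simp)
  then show "54000 * \<sigma>\<^sup>2 * logK K \<beta> * (ln B)\<^sup>2 / (\<mu>\<^sup>2 * (real K + 1)) \<le> \<epsilon>"
    using pos by (simp add: L_def field_simps add_pos_nonneg)
qed

section \<open>Iterations and oracle calls of the two choices\<close>

lemma cond_a_gamma_large:
  assumes "0 < ell" "0 < \<beta>" "\<beta> \<le> 1"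
  shows "cond_a ell K \<beta> (gamma_large ell K \<beta>)"
  using assms logK_ge_1[of \<beta> K] by (simp add: cond_a_def gamma_large_def)

lemma cond_b_batch_large: "cond_b \<mu> R \<sigma> K \<beta> (gamma_large ell K \<beta>) (batch_large \<mu> ell R \<sigma> K \<beta>)"
  unfolding cond_b_def batch_large_def by (auto intro: of_nat_ceiling)

lemma horizon_large:
  fixes \<mu> ell R \<sigma> \<beta> \<epsilon> :: real
  assumes pos: "0 < \<mu>" "\<mu> \<le> ell" "0 < R" "0 < \<beta>" "\<beta> \<le> 1" and reg: "eps_regime_large \<mu> ell R \<beta> \<epsilon>"
  obtains K where "real (K + 1) \<le> 8000000 * iter_large \<mu> ell R \<beta> \<epsilon>"
    and "216000 * (ell / \<mu> * ln (R\<^sup>2 / \<epsilon>)) * logK K \<beta> \<le> real K + 1"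
proof -
  define P where "P = ell / \<mu> * ln (R\<^sup>2 / \<epsilon>)"
  define W where "W = ln (ell / (\<mu> * \<beta>) * ln (R\<^sup>2 / \<epsilon>))"
  have l: "1 \<le> ln (R\<^sup>2 / \<epsilon>)" and W: "1 \<le> W" using reg by (auto simp: eps_regime_large_def W_def)
  have "1 * 1 \<le> ell / \<mu> * ln (R\<^sup>2 / \<epsilon>)" using pos l by (intro mult_mono) auto
  then have P: "1 \<le> P" by (simp add: P_def)
  have WP: "W = ln (P / \<beta>)" by (simp add: W_def P_def)
  have "ln (P * W / \<beta>) = ln (P / \<beta>) + ln W"
    using ln_mult[of "P / \<beta>" W] P W pos by (simp add: mult_ac)
  also have "\<dots> \<le> 4 * W" using W ln_le_minus_one[of W] unfolding WP[symmetric] by simp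
  finally have "ln (P * W / \<beta>) \<le> 4 * W" .
  from horizon_exists[OF P W pos(4) this] obtain K where
    "real K + 1 \<le> 8000000 * (P * W)" "216000 * P * logK K \<beta> \<le> real K + 1" .
  then show thesis by (intro that) (auto simp: P_def W_def iter_large_def)
qed

text \<open>The 2 per step pays for the lower bound 1 on a batch and for rounding up. The geometric
  sum contributes \<open>1 / (\<gamma> * \<mu>)\<close>, which leaves
  \<open>\<gamma> * L = 1 / (400 * ell)\<close> of the batch formula, and
  \<open>27000 / 400 = 135 / 2\<close>.\<close>

lemma oracle_calls_large_le:
  fixes \<mu> ell R \<sigma> \<beta> :: real
  assumes pos: "0 < \<mu>" "0 < ell" "0 < R" "0 < \<beta>" "\<beta> \<le> 1"
  shows "real (oracle_calls (batch_large \<mu> ell R \<sigma> K \<beta>) K) \<le> 2 * (real K + 1)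
    + 135 / 2 * (real K + 1) * \<sigma>\<^sup>2 * exp (\<mu> * (real K + 1) / (400 * ell * logK K \<beta>)) / (ell * \<mu> * R\<^sup>2)"
proof -
  define L where "L = logK K \<beta>"
  define g where "g = gamma_large ell K \<beta>"
  define n where "n = real K + 1"
  define c where "c = 27000 * g\<^sup>2 * n * \<sigma>\<^sup>2 * L / R\<^sup>2"
  have L: "1 \<le> L" using logK_ge_1[of \<beta> K] pos by (simp add: L_def)
  have g: "g = 1 / (400 * ell * L)" "0 < g" using L pos by (simp_all add: g_def gamma_large_def L_def)
  have n1: "1 \<le> n" by (simp add: n_def)
  have c0: "0 \<le> c" using L n1 by (simp add: c_def)
  have "real (batch_large \<mu> ell R \<sigma> K \<beta> k) \<le> 2 + c * exp (g * \<mu> * real k)" for k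
  proof -
    have "batch_bound g \<mu> R \<sigma> K \<beta> k = max 1 (c * exp (g * \<mu> * real k))"
      by (simp add: batch_bound_def c_def exp_minus L_def n_def field_simps)
    also have "\<dots> \<le> 1 + c * exp (g * \<mu> * real k)" using c0 by simp
    finally have "batch_bound g \<mu> R \<sigma> K \<beta> k \<le> 1 + c * exp (g * \<mu> * real k)" .
    moreover have "1 \<le> batch_bound g \<mu> R \<sigma> K \<beta> k" by (simp add: batch_bound_def)
    ultimately show ?thesis
      unfolding batch_large_def g_def[symmetric] by linarith
  qed
  then have "real (oracle_calls (batch_large \<mu> ell R \<sigma> K \<beta>) K) \<le> (\<Sum>k = 0..K. 2 + c * exp (g * \<mu> * real k))"
    unfolding oracle_calls_def of_nat_sum by (intro sum_mono)
  also have "\<dots> = 2 * n + c * (\<Sum>k = 0..K. exp (g * \<mu> * real k))"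
    by (simp add: sum.distrib sum_distrib_left n_def)
  also have "\<dots> \<le> 2 * n + c * (exp (g * \<mu> * n) / (g * \<mu>))"
    unfolding n_def using sum_exp_le[of "g * \<mu>" K] g pos c0 by (intro add_left_mono mult_left_mono) auto
  also have "c * (exp (g * \<mu> * n) / (g * \<mu>)) = 27000 * (g * L) * n * \<sigma>\<^sup>2 * exp (g * \<mu> * n) / (\<mu> * R\<^sup>2)"
    using g(2) pos by (simp add: c_def field_simps power2_eq_square)
  also have "g * L = 1 / (400 * ell)" using L by (simp add: g(1))
  also have "g * \<mu> * n = \<mu> * n / (400 * ell * L)" by (simp add: g(1))
  finally show ?thesis by (simp add: n_def L_def mult_ac)
qed

text \<open>Batches grow like \<open>exp (\<gamma> * \<mu> * k)\<close>, so a horizon too long by a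
  constant factor could turn \<open>R\<^sup>2 / \<epsilon>\<close> into a power of it. The witness
  is therefore the least horizon that reaches the accuracy; the explicit \<open>K0\<close> shows
  that one exists and bounds it.\<close>

lemma large_complexity:
  fixes \<mu> ell R \<sigma> \<beta> \<epsilon> :: real
  assumes pos: "0 < \<mu>" "\<mu> \<le> ell" "0 < R" "0 < \<beta>" "\<beta> \<le> 1" and reg: "eps_regime_large \<mu> ell R \<beta> \<epsilon>"
  obtains K where "real (K + 1) \<le> 10 ^ 10 * iter_large \<mu> ell R \<beta> \<epsilon>"
    and "real (oracle_calls (batch_large \<mu> ell R \<sigma> K \<beta>) K) \<le> 10 ^ 10 * calls_large \<mu> ell R \<sigma> \<beta> \<epsilon>"
    and "rate_large \<mu> ell R K \<beta> \<le> \<epsilon>"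
proof -
  have ell: "0 < ell" using pos by simp
  have \<epsilon>: "0 < \<epsilon>" and l: "1 \<le> ln (R\<^sup>2 / \<epsilon>)" and W: "1 \<le> ln (ell / (\<mu> * \<beta>) * ln (R\<^sup>2 / \<epsilon>))"
    using reg by (auto simp: eps_regime_large_def)
  have L: "1 \<le> logK K \<beta>" for K using logK_ge_1 pos by simp
  have \<mu>L: "\<mu> / (400 * ell * logK K \<beta>) \<le> 1" for K
  proof -
    have "ell * 1 \<le> ell * (400 * logK K \<beta>)" using ell L[of K] by (intro mult_left_mono) auto
    then have "\<mu> \<le> 400 * ell * logK K \<beta>" using pos by linarith
    then show ?thesis using ell L[of K] by (simp add: divide_le_eq)
  qed
  obtain K0 where K0: "real (K0 + 1) \<le> 8000000 * iter_large \<mu> ell R \<beta> \<epsilon>"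
    "216000 * (ell / \<mu> * ln (R\<^sup>2 / \<epsilon>)) * logK K0 \<beta> \<le> real K0 + 1"
    using horizon_large[OF pos reg] .
  have "rate_large \<mu> ell R K0 \<beta> \<le> \<epsilon>"
  proof (rule rate_large_le_of_horizon[OF _ _ _ _ _ l])
    have "0 \<le> ell / \<mu> * ln (R\<^sup>2 / \<epsilon>) * logK K0 \<beta>" using pos ell l L[of K0] by auto
    then show "800 * (ell / \<mu> * ln (R\<^sup>2 / \<epsilon>)) * logK K0 \<beta> \<le> real K0 + 1"
      using K0(2) by linarith
  qed (use pos ell \<epsilon> L[of K0] in auto)
  define K where "K = (LEAST K. rate_large \<mu> ell R K \<beta> \<le> \<epsilon>)"
  have K: "rate_large \<mu> ell R K \<beta> \<le> \<epsilon>"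
    unfolding K_def by (rule LeastI) fact
  have "K \<le> K0" unfolding K_def by (rule Least_le) fact
  then have n_le: "real K + 1 \<le> 8000000 * iter_large \<mu> ell R \<beta> \<epsilon>" using K0 by simp
  define E where "E = exp (\<mu> * (real K + 1) / (400 * ell * logK K \<beta>))"
  have R\<epsilon>: "1 \<le> R\<^sup>2 / \<epsilon>" using l \<epsilon> pos by (smt (verit) divide_pos_pos ln_ge_iff one_le_exp_iff zero_less_power)
  \<comment> \<open>By minimality the step count before the last one misses the accuracy, which bounds the batch growth.\<close>
  have E: "E \<le> 6 * (R\<^sup>2 / \<epsilon>)"
  proof (cases K)
    case 0
    have "\<mu> * (real K + 1) / (400 * ell * logK K \<beta>) \<le> 1"
      using 0 \<mu>L[of 0] by simp
    then have "E \<le> exp 1" by (simp add: E_def)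
    then show ?thesis using exp_le R\<epsilon> by linarith
  next
    case (Suc j)
    have "\<not> rate_large \<mu> ell R j \<beta> \<le> \<epsilon>"
      using not_less_Least[of j "\<lambda>K. rate_large \<mu> ell R K \<beta> \<le> \<epsilon>"] Suc by (simp add: K_def)
    then have "\<epsilon> < 2 * exp (- (\<mu> * (real j + 1) / (400 * ell * logK j \<beta>))) * R\<^sup>2"
      by (simp add: rate_large_def)
    then have e: "exp (\<mu> * (real j + 1) / (400 * ell * logK j \<beta>)) \<le> 2 * (R\<^sup>2 / \<epsilon>)"
      using \<epsilon> by (simp add: exp_minus field_simps)
    have Lj: "logK j \<beta> \<le> logK K \<beta>"
      unfolding logK_def using pos Suc by (intro ln_mono divide_right_mono) auto
    \<comment> \<open>Passing to the smaller \<open>logK j\<close> only enlarges the exponent, and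
      the one additional step adds at most 1 to it; hence the factor
      \<open>exp 1 \<le> 3\<close>.\<close>
    have "\<mu> * (real K + 1) / (400 * ell * logK K \<beta>) \<le> \<mu> * (real K + 1) / (400 * ell * logK j \<beta>)"
      using pos ell L[of j] L[of K] Lj by (intro divide_left_mono mult_left_mono mult_pos_pos) auto
    also have "\<dots> = \<mu> * (real j + 1) / (400 * ell * logK j \<beta>) + \<mu> / (400 * ell * logK j \<beta>)"
      using Suc by (simp add: field_simps add_divide_distrib)
    also have "\<mu> / (400 * ell * logK j \<beta>) \<le> 1"
      by (rule \<mu>L)
    finally have "E \<le> exp (\<mu> * (real j + 1) / (400 * ell * logK j \<beta>) + 1)" by (simp add: E_def)
    also have "\<dots> = exp (\<mu> * (real j + 1) / (400 * ell * logK j \<beta>)) * exp 1" by (rule exp_add)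
    also have "\<dots> \<le> 2 * (R\<^sup>2 / \<epsilon>) * 3" using e exp_le \<epsilon> by (intro mult_mono) auto
    finally show ?thesis by simp
  qed
  define U where "U = ln (R\<^sup>2 / \<epsilon>) * ln (ell / (\<mu> * \<beta>) * ln (R\<^sup>2 / \<epsilon>))"
  define S where "S = max (ell / \<mu>) (\<sigma>\<^sup>2 / (\<mu>\<^sup>2 * \<epsilon>))"
  have U0: "0 \<le> U" using l W by (simp add: U_def)
  have iU: "iter_large \<mu> ell R \<beta> \<epsilon> = ell / \<mu> * U" by (simp add: iter_large_def U_def)
  have cU: "calls_large \<mu> ell R \<sigma> \<beta> \<epsilon> = S * U" by (simp add: calls_large_def U_def S_def)
  have S1: "ell / \<mu> * U \<le> S * U" "\<sigma>\<^sup>2 / (\<mu>\<^sup>2 * \<epsilon>) * U \<le> S * U"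
    unfolding S_def using U0 by (intro mult_right_mono; simp)+
  have SU0: "0 \<le> S * U" using U0 pos ell \<epsilon> by (simp add: S_def max_def)
  have "135 / 2 * (real K + 1) * \<sigma>\<^sup>2 * E / (ell * \<mu> * R\<^sup>2)
      \<le> 135 / 2 * (8000000 * (ell / \<mu> * U)) * \<sigma>\<^sup>2 * (6 * (R\<^sup>2 / \<epsilon>)) / (ell * \<mu> * R\<^sup>2)"
    using n_le E pos ell U0 unfolding iU by (intro divide_right_mono mult_mono) (auto simp: E_def)
  \<comment> \<open>The \<open>R\<^sup>2 / \<epsilon>\<close> from \<open>E\<close> cancels
    \<open>R\<^sup>2\<close>, and \<open>ell\<close> cancels against the iteration bound: what
    remains is the noise part of \<open>calls_large\<close>.\<close>
  also have "\<dots> = 3240000000 * (\<sigma>\<^sup>2 / (\<mu>\<^sup>2 * \<epsilon>) * U)"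
    using pos ell \<epsilon> by (simp add: field_simps power2_eq_square)
  also have "\<dots> \<le> 3240000000 * (S * U)" using S1(2) by (rule mult_left_mono) simp
  finally have T: "135 / 2 * (real K + 1) * \<sigma>\<^sup>2 * E / (ell * \<mu> * R\<^sup>2) \<le> 3240000000 * (S * U)" .
  have "real K + 1 \<le> 8000000 * (S * U)"
    using n_le[unfolded iU] S1(1) by (rule order_trans[OF _ mult_left_mono]) simp
  then have n: "2 * (real K + 1) \<le> 16000000 * (S * U)" by simp
  have "real (oracle_calls (batch_large \<mu> ell R \<sigma> K \<beta>) K)
      \<le> 2 * (real K + 1) + 135 / 2 * (real K + 1) * \<sigma>\<^sup>2 * E / (ell * \<mu> * R\<^sup>2)"
    unfolding E_def by (rule oracle_calls_large_le[OF pos(1) ell pos(3-5)])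
  also have "\<dots> \<le> 16000000 * (S * U) + 3240000000 * (S * U)" by (rule add_mono[OF n T])
  also have "\<dots> \<le> 10 ^ 10 * (S * U)" using SU0 by simp
  finally have c: "real (oracle_calls (batch_large \<mu> ell R \<sigma> K \<beta>) K) \<le> 10 ^ 10 * calls_large \<mu> ell R \<sigma> \<beta> \<epsilon>"
    unfolding cU .
  have "0 \<le> iter_large \<mu> ell R \<beta> \<epsilon>" unfolding iU using U0 pos ell by simp
  then have "real (K + 1) \<le> 10 ^ 10 * iter_large \<mu> ell R \<beta> \<epsilon>" using n_le by simp
  then show thesis using that c K by blast
qed

text \<open>The thresholds \<open>ell / \<mu> * l\<close> and \<open>u * l\<^sup>2\<close> share a
  factor \<open>l\<close>, so comparing \<open>ell / \<mu>\<close> with \<open>u * l\<close> decides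
  which is larger, and a horizon for the larger one serves both. This is the case split built into
  \<open>eps_regime_small\<close>.\<close>

lemma small_complexity:
  fixes \<mu> ell R \<sigma> \<beta> \<epsilon> :: real
  assumes pos: "0 < \<mu>" "\<mu> \<le> ell" "0 < R" "0 < \<sigma>" "0 < \<beta>" "\<beta> \<le> 1"
    and reg: "eps_regime_small \<mu> ell R \<sigma> \<beta> \<epsilon>"
  obtains K where "real (K + 1) \<le> 10 ^ 10 * iter_small \<mu> ell R \<sigma> \<beta> \<epsilon>"
    and "rate_small \<mu> ell R \<sigma> K \<beta> \<le> \<epsilon>"
    and "2 \<le> B_arg \<mu> R \<sigma> K \<beta> / (ln (B_K \<mu> R \<sigma> K \<beta>))\<^sup>2"
proof -
  define l where "l = ln (R\<^sup>2 / \<epsilon>)"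
  define u where "u = \<sigma>\<^sup>2 / (\<mu>\<^sup>2 * \<epsilon>)"
  define w where "w = ln (\<sigma>\<^sup>2 / (\<mu>\<^sup>2 * \<epsilon> * \<beta>))"
  have ell: "0 < ell" using pos by simp
  have regl: "eps_regime_large \<mu> ell R \<beta> \<epsilon>" using reg by (simp add: eps_regime_small_def)
  have \<epsilon>: "0 < \<epsilon>" and l: "1 \<le> l" and W: "1 \<le> ln (ell / (\<mu> * \<beta>) * l)"
    using regl by (auto simp: eps_regime_large_def l_def)
  have u0: "0 < u" using pos \<epsilon> by (simp add: u_def)
  have L: "0 < logK K \<beta>" for K using logK_ge_1[of \<beta> K] pos by simp
  note result = that
  have conclude: thesis
    if n: "real K + 1 \<le> 10 ^ 10 * iter_small \<mu> ell R \<sigma> \<beta> \<epsilon>"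
      and n1: "216000 * (ell / \<mu> * l) * logK K \<beta> \<le> real K + 1"
      and n2: "216000 * (u * l\<^sup>2) * logK K \<beta> \<le> real K + 1" for K
  proof (rule result)
    show "real (K + 1) \<le> 10 ^ 10 * iter_small \<mu> ell R \<sigma> \<beta> \<epsilon>" using n by simp
    have "rate_large \<mu> ell R K \<beta> \<le> \<epsilon>"
    proof (rule rate_large_le_of_horizon[OF _ _ _ _ _ l[unfolded l_def]])
      have "0 \<le> ell / \<mu> * l * logK K \<beta>" using pos ell l L[of K] by auto
      then show "800 * (ell / \<mu> * ln (R\<^sup>2 / \<epsilon>)) * logK K \<beta> \<le> real K + 1"
        using n1 unfolding l_def by linarith
    qed (use pos ell \<epsilon> L[of K] in auto)
    moreover note B = small_noise_le_of_horizon[OF pos(1,4,3) \<epsilon> L l[unfolded l_def] n2[unfolded l_def u_def]]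
    ultimately show "rate_small \<mu> ell R \<sigma> K \<beta> \<le> \<epsilon>" by (simp add: rate_small_def rate_large_def)
    show "2 \<le> B_arg \<mu> R \<sigma> K \<beta> / (ln (B_K \<mu> R \<sigma> K \<beta>))\<^sup>2" by (rule B(1))
  qed
  show thesis
  proof (cases "u * l \<le> ell / \<mu>")
    case True
    obtain K where K: "real (K + 1) \<le> 8000000 * iter_large \<mu> ell R \<beta> \<epsilon>"
      "216000 * (ell / \<mu> * ln (R\<^sup>2 / \<epsilon>)) * logK K \<beta> \<le> real K + 1"
      using horizon_large[OF pos(1,2,3,5,6) regl] .
    have i: "iter_large \<mu> ell R \<beta> \<epsilon> \<le> iter_small \<mu> ell R \<sigma> \<beta> \<epsilon>"
      by (simp add: iter_large_def iter_small_def)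
    have i0: "0 \<le> iter_large \<mu> ell R \<beta> \<epsilon>" using K(1) by linarith
    show thesis
    proof (rule conclude)
      show "real K + 1 \<le> 10 ^ 10 * iter_small \<mu> ell R \<sigma> \<beta> \<epsilon>" using K(1) i i0 by simp
      show n1: "216000 * (ell / \<mu> * l) * logK K \<beta> \<le> real K + 1" using K(2) by (simp add: l_def)
      have "u * l\<^sup>2 \<le> ell / \<mu> * l" using mult_right_mono[OF True, of l] l by (simp add: power2_eq_square mult.assoc)
      then have "216000 * (u * l\<^sup>2) * logK K \<beta> \<le> 216000 * (ell / \<mu> * l) * logK K \<beta>"
        using L[of K] by (intro mult_right_mono) auto
      then show "216000 * (u * l\<^sup>2) * logK K \<beta> \<le> real K + 1" using n1 by linarith
    qed
  next
    case False
    then have w: "1 \<le> w" "ln l \<le> w" "w\<^sup>2 \<le> R\<^sup>2 / \<epsilon>"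
      using reg unfolding eps_regime_small_def u_def l_def w_def by auto
    have wu: "w = ln (u / \<beta>)" by (simp add: w_def u_def)
    have "1 \<le> ell / \<mu>" using pos by simp
    then have ul: "1 \<le> u * l" using False by linarith
    have "1 * 1 \<le> (u * l) * l" using ul l by (intro mult_mono) auto
    then have P: "1 \<le> u * l\<^sup>2" by (simp add: power2_eq_square mult.assoc)
    have "ln (u * l\<^sup>2 * w / \<beta>) = ln (u / \<beta>) + ln (l\<^sup>2) + ln w"
      using ln_mult[of "u / \<beta> * l\<^sup>2" w] ln_mult[of "u / \<beta>" "l\<^sup>2"] u0 l w pos by (simp add: mult_ac)
    also have "\<dots> = w + 2 * ln l + ln w" using l by (simp add: wu ln_realpow)
    also have "\<dots> \<le> 4 * w" using w ln_le_minus_one[of w] by simp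
    finally have lnP: "ln (u * l\<^sup>2 * w / \<beta>) \<le> 4 * w" .
    obtain K where K: "real K + 1 \<le> 8000000 * (u * l\<^sup>2 * w)" "216000 * (u * l\<^sup>2) * logK K \<beta> \<le> real K + 1"
      using horizon_exists[OF P w(1) pos(5) lnP] .
    define b where "b = ln (B_eps \<mu> R \<sigma> \<beta> \<epsilon>)"
    \<comment> \<open>The horizon is proportional to \<open>l\<^sup>2\<close>, the claimed bound to
      \<open>b\<^sup>2\<close>; the exchange costs \<open>20\<^sup>2 = 400\<close>.\<close>
    have "l / 20 \<le> b"
      using ln_B_eps_ge[of "R\<^sup>2 / \<epsilon>" w] l w \<epsilon> pos
      by (simp add: b_def B_eps_def Let_def w_def[symmetric] l_def)
    then have "l\<^sup>2 \<le> (20 * b)\<^sup>2" using l by (intro power_mono) auto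
    then have "u * w * l\<^sup>2 \<le> u * w * (20 * b)\<^sup>2" using u0 w by (intro mult_left_mono) auto
    also have "\<dots> = 400 * (u * w * b\<^sup>2)" by (simp add: power_mult_distrib)
    also have "u * w * b\<^sup>2 \<le> iter_small \<mu> ell R \<sigma> \<beta> \<epsilon>"
      by (simp add: iter_small_def b_def u_def w_def)
    finally have i: "u * l\<^sup>2 * w \<le> 400 * iter_small \<mu> ell R \<sigma> \<beta> \<epsilon>" by (simp add: mult_ac)
    show thesis
    proof (rule conclude)
      have "0 \<le> iter_small \<mu> ell R \<sigma> \<beta> \<epsilon>" using K(1) i by linarith
      then show "real K + 1 \<le> 10 ^ 10 * iter_small \<mu> ell R \<sigma> \<beta> \<epsilon>" using K(1) i by simp
      show "216000 * (u * l\<^sup>2) * logK K \<beta> \<le> real K + 1" by (rule K(2))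
      have "ell / \<mu> * l \<le> u * l\<^sup>2" using mult_right_mono[of "ell / \<mu>" "u * l" l] False l by (simp add: power2_eq_square mult.assoc)
      then have "216000 * (ell / \<mu> * l) * logK K \<beta> \<le> 216000 * (u * l\<^sup>2) * logK K \<beta>"
        using L[of K] by (intro mult_right_mono) auto
      then show "216000 * (ell / \<mu> * l) * logK K \<beta> \<le> real K + 1" using K(2) by linarith
    qed
  qed
qed

section \<open>Conditions (a), (b) and guarantees for the two choices\<close>

context clipped_sgda_setting
begin

lemma B_arg_pos: "0 < \<mu> \<Longrightarrow> 0 < \<sigma> \<Longrightarrow> 0 < \<beta> \<Longrightarrow> \<beta> \<le> 1 \<Longrightarrow> 0 < B_arg \<mu> R \<sigma> K \<beta>"
  using R_pos logK_ge_1[of \<beta> K] by (simp add: B_arg_def add_pos_nonneg)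

lemma large_high_probability:
  assumes "0 < \<beta>" "\<beta> \<le> 1" "rate_large \<mu> ell R K \<beta> \<le> \<epsilon>"
  shows "1 - \<beta> \<le> \<P>(\<omega> in M. (norm (sgda_output G \<xi> x0 R \<mu> K \<beta> (gamma_large ell K \<beta>)
    (batch_large \<mu> ell R \<sigma> K \<beta>) \<omega> - xs))\<^sup>2 \<le> \<epsilon>)"
proof (rule clipped_sgda_high_probability[OF assms(1,2) cond_a_gamma_large cond_b_batch_large])
  have "gamma_large ell K \<beta> * \<mu> * (real K + 1) = \<mu> * (real K + 1) / (400 * ell * logK K \<beta>)"
    by (simp add: gamma_large_def)
  then show "2 * exp (- (gamma_large ell K \<beta> * \<mu> * (real K + 1))) * R\<^sup>2 \<le> \<epsilon>"
    using assms(3) by (simp add: rate_large_def)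
qed (use assms ell_pos in auto)

lemma B_K_ge_2:
  assumes "0 < \<mu>" "0 < \<sigma>" "0 < \<beta>" "\<beta> \<le> 1"
  shows "2 \<le> B_K \<mu> R \<sigma> K \<beta>"
  using B_K_eq[OF B_arg_pos[OF assms, of K]] by (metis max.cobounded1)

lemma cond_a_gamma_small:
  assumes "0 < \<mu>" "0 < \<sigma>" "0 < \<beta>" "\<beta> \<le> 1"
  shows "cond_a ell K \<beta> (gamma_small \<mu> ell R \<sigma> K \<beta>)"
  using B_K_ge_2[OF assms, of K] logK_ge_1[OF assms(3,4), of K] assms(1) ell_pos
  by (simp add: cond_a_def gamma_small_def)

text \<open>The stepsize satisfies \<open>\<gamma> * \<mu> * (K + 1) \<le> ln B\<close>. Hence the
  growth \<open>exp (\<gamma> * \<mu> * k)\<close> is at most \<open>B\<close> and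
  \<open>(\<gamma> * \<mu> * (K + 1))\<^sup>2\<close> at most \<open>(ln B)\<^sup>2\<close>; their
  product is at most \<open>B * (ln B)\<^sup>2\<close>, which on this branch of the maximum equals
  \<open>B_arg\<close>. That is the batch condition for batches of size 1.\<close>

lemma cond_b_unit_batch:
  assumes pos: "0 < \<mu>" "0 < \<sigma>" "0 < \<beta>" "\<beta> \<le> 1"
    and B: "2 \<le> B_arg \<mu> R \<sigma> K \<beta> / (ln (B_K \<mu> R \<sigma> K \<beta>))\<^sup>2"
  shows "cond_b \<mu> R \<sigma> K \<beta> (gamma_small \<mu> ell R \<sigma> K \<beta>) (\<lambda>k. 1)"
  unfolding cond_b_def
proof (intro allI impI)
  fix k assume k: "k \<le> K"
  define b where "b = B_K \<mu> R \<sigma> K \<beta>"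
  define g where "g = gamma_small \<mu> ell R \<sigma> K \<beta>"
  define L where "L = logK K \<beta>"
  define n where "n = real K + 1"
  have n: "1 \<le> n" by (simp add: n_def)
  have L: "1 \<le> L" using logK_ge_1[OF pos(3,4)] by (simp add: L_def)
  have b2: "2 \<le> b" using B_K_ge_2[OF pos(1-4)] by (simp add: b_def)
  have lnb: "0 < ln b" using b2 by simp
  have "b = B_arg \<mu> R \<sigma> K \<beta> / (ln b)\<^sup>2"
    using B_K_eq[OF B_arg_pos[OF pos, of K]] B unfolding b_def by linarith
  then have "b * (ln b)\<^sup>2 = B_arg \<mu> R \<sigma> K \<beta>"
    using lnb by (metis less_irrefl nonzero_eq_divide_eq power_eq_0_iff)
  then have bL: "b * (ln b)\<^sup>2 * (27000 * \<sigma>\<^sup>2 * L) = n * \<mu>\<^sup>2 * R\<^sup>2"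
    using pos L by (simp add: B_arg_def L_def n_def)
  have g: "0 < g" using cond_a_gamma_small[OF pos] by (simp add: cond_a_def g_def)
  have "g \<le> ln b / (\<mu> * n)" by (simp add: g_def gamma_small_def b_def n_def)
  then have gn: "g * \<mu> * n \<le> ln b" using pos n by (simp add: field_simps)
  have "g * \<mu> * real k \<le> g * \<mu> * n" using k g pos by (intro mult_left_mono) (auto simp: n_def)
  then have "exp (g * \<mu> * real k) \<le> exp (ln b)" using gn by simp
  then have e: "exp (g * \<mu> * real k) \<le> b" using b2 by simp
  have "(g * \<mu> * n)\<^sup>2 \<le> (ln b)\<^sup>2" using gn g pos n by (intro power_mono) auto
  then have "(g * \<mu> * n)\<^sup>2 * exp (g * \<mu> * real k) * (27000 * \<sigma>\<^sup>2 * L) \<le> (ln b)\<^sup>2 * b * (27000 * \<sigma>\<^sup>2 * L)"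
    using e L by (intro mult_right_mono mult_mono) auto
  also have "\<dots> = n * \<mu>\<^sup>2 * R\<^sup>2" using bL by (simp add: mult.commute)
  finally have "27000 * g\<^sup>2 * n * \<sigma>\<^sup>2 * L * exp (g * \<mu> * real k) * (n * \<mu>\<^sup>2) \<le> R\<^sup>2 * (n * \<mu>\<^sup>2)"
    by (simp add: power_mult_distrib power2_eq_square mult_ac)
  then have "27000 * g\<^sup>2 * n * \<sigma>\<^sup>2 * L * exp (g * \<mu> * real k) \<le> R\<^sup>2"
    by (rule mult_right_le_imp_le) (use pos n in simp)
  then have "27000 * g\<^sup>2 * n * \<sigma>\<^sup>2 * L / (exp (- g * \<mu> * real k) * R\<^sup>2) \<le> 1"
    using R_pos by (simp add: exp_minus field_simps)
  then show "batch_bound (gamma_small \<mu> ell R \<sigma> K \<beta>) \<mu> R \<sigma> K \<beta> k \<le> real 1"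
    by (simp add: batch_bound_def g_def n_def L_def)
qed

text \<open>The two arguments of the maximum in the rate correspond to the two arguments of the
  minimum in the stepsize: the second stepsize gives
  \<open>exp (- \<gamma> * \<mu> * (K + 1)) = 1 / B\<close>.\<close>

lemma small_high_probability:
  assumes pos: "0 < \<mu>" "0 < \<sigma>" "0 < \<beta>" "\<beta> \<le> 1"
    and b: "cond_b \<mu> R \<sigma> K \<beta> (gamma_small \<mu> ell R \<sigma> K \<beta>) m"
    and \<epsilon>: "rate_small \<mu> ell R \<sigma> K \<beta> \<le> \<epsilon>"
  shows "1 - \<beta> \<le> \<P>(\<omega> in M. (norm (sgda_output G \<xi> x0 R \<mu> K \<beta> (gamma_small \<mu> ell R \<sigma> K \<beta>)
    m \<omega> - xs))\<^sup>2 \<le> \<epsilon>)"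
proof (rule clipped_sgda_high_probability[OF pos(3,4) cond_a_gamma_small[OF pos] b])
  define B where "B = B_K \<mu> R \<sigma> K \<beta>"
  define A where "A = B_arg \<mu> R \<sigma> K \<beta>"
  define g where "g = gamma_small \<mu> ell R \<sigma> K \<beta>"
  define L where "L = logK K \<beta>"
  define n where "n = real K + 1"
  have n: "1 \<le> n" by (simp add: n_def)
  have L: "1 \<le> L" using logK_ge_1[OF pos(3,4)] by (simp add: L_def)
  have A0: "0 < A" using B_arg_pos[OF pos] by (simp add: A_def)
  have B2: "2 \<le> B" using B_K_ge_2[OF pos] by (simp add: B_def)
  have lnB: "0 < ln B" using B2 by simp
  have "g = 1 / (400 * ell * L) \<or> g = ln B / (\<mu> * n)"
    by (simp add: g_def gamma_small_def B_def n_def L_def min_def)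
  then consider "g = 1 / (400 * ell * L)" | "g = ln B / (\<mu> * n)" by blast
  then have "2 * exp (- (g * \<mu> * n)) * R\<^sup>2 \<le> rate_small \<mu> ell R \<sigma> K \<beta>"
  proof cases
    case 1
    then have "g * \<mu> * n = \<mu> * n / (400 * ell * L)" by simp
    then show ?thesis by (simp add: rate_small_def n_def L_def)
  next
    case 2
    then have "g * \<mu> * n = ln B" using pos n by simp
    then have "2 * exp (- (g * \<mu> * n)) * R\<^sup>2 = 2 * R\<^sup>2 / B" using B2 by (simp add: exp_minus field_simps)
    also have "\<dots> \<le> 54000 * \<sigma>\<^sup>2 * L * (ln B)\<^sup>2 / (\<mu>\<^sup>2 * n)"
    proof -
      \<comment> \<open>This inequality holds on either branch of the maximum that defines
        \<open>B\<close>.\<close>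
      have "A / (ln B)\<^sup>2 \<le> B" using B_K_eq[OF B_arg_pos[OF pos, of K]] unfolding A_def B_def by linarith
      then have "A \<le> B * (ln B)\<^sup>2" using lnB by (simp add: field_simps)
      then have "A * (27000 * \<sigma>\<^sup>2 * L) \<le> B * (ln B)\<^sup>2 * (27000 * \<sigma>\<^sup>2 * L)"
        using L by (intro mult_right_mono) auto
      also have "A * (27000 * \<sigma>\<^sup>2 * L) = n * \<mu>\<^sup>2 * R\<^sup>2"
        using pos L by (simp add: A_def B_arg_def L_def n_def)
      finally show ?thesis using pos n B2 by (simp add: field_simps)
    qed
    also have "\<dots> \<le> rate_small \<mu> ell R \<sigma> K \<beta>" by (simp add: rate_small_def n_def L_def B_def)
    finally show ?thesis .
  qed
  then show "2 * exp (- (gamma_small \<mu> ell R \<sigma> K \<beta> * \<mu> * (real K + 1))) * R\<^sup>2 \<le> \<epsilon>"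
    using \<epsilon> by (simp add: g_def n_def)
qed

end



theorem corollaryD3:
  shows "\<exists>C>0. \<forall>(M :: 'w measure) (D :: 's measure) (G :: 's \<Rightarrow> 'a \<Rightarrow> 'a::euclidean_space) F \<xi> x0 xs R \<mu> ell \<sigma> \<beta>.
    clipped_sgda_setting M D G F \<xi> x0 xs R \<mu> ell \<sigma> \<and> 0 < \<beta> \<and> \<beta> \<le> 1 \<longrightarrow>
    (\<forall>K. 1 \<le> ln (4 * (real K + 1) / \<beta>) \<longrightarrow>
       (let \<gamma> = gamma_large ell K \<beta>; m = batch_large \<mu> ell R \<sigma> K \<beta> in
          cond_a ell K \<beta> \<gamma> \<and> cond_b \<mu> R \<sigma> K \<beta> \<gamma> m \<and>
          \<P>(\<omega> in M. (norm (sgda_output G \<xi> x0 R \<mu> K \<beta> \<gamma> m \<omega> - xs))\<^sup>2 \<le> rate_large \<mu> ell R K \<beta>)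
            \<ge> 1 - \<beta>)) \<and>
    (0 < \<mu> \<longrightarrow> (\<forall>\<epsilon>. eps_regime_large \<mu> ell R \<beta> \<epsilon> \<longrightarrow>
       (\<exists>K. let \<gamma> = gamma_large ell K \<beta>; m = batch_large \<mu> ell R \<sigma> K \<beta> in
          real (K + 1) \<le> C * iter_large \<mu> ell R \<beta> \<epsilon> \<and>
          real (oracle_calls m K) \<le> C * calls_large \<mu> ell R \<sigma> \<beta> \<epsilon> \<and>
          rate_large \<mu> ell R K \<beta> \<le> \<epsilon> \<and>
          \<P>(\<omega> in M. (norm (sgda_output G \<xi> x0 R \<mu> K \<beta> \<gamma> m \<omega> - xs))\<^sup>2 \<le> \<epsilon>) \<ge> 1 - \<beta>))) \<and>
    (0 < \<mu> \<and> 0 < \<sigma> \<longrightarrow>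
       (\<forall>K. 1 \<le> ln (4 * (real K + 1) / \<beta>) \<longrightarrow>
          (let B = B_K \<mu> R \<sigma> K \<beta>; A = B_arg \<mu> R \<sigma> K \<beta>;
               \<gamma> = gamma_small \<mu> ell R \<sigma> K \<beta>; m = (\<lambda>k. 1) in
             B = max 2 (A / (ln B)\<^sup>2) \<and>
             B \<le> C * max 2 (A / (ln (max 2 A))\<^sup>2) \<and>
             cond_a ell K \<beta> \<gamma> \<and>
             (2 \<le> A / (ln B)\<^sup>2 \<longrightarrow> cond_b \<mu> R \<sigma> K \<beta> \<gamma> m) \<and>
             (cond_b \<mu> R \<sigma> K \<beta> \<gamma> m \<longrightarrow>
                \<P>(\<omega> in M. (norm (sgda_output G \<xi> x0 R \<mu> K \<beta> \<gamma> m \<omega> - xs))\<^sup>2 \<le> rate_small \<mu> ell R \<sigma> K \<beta>)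
                  \<ge> 1 - \<beta>))) \<and>
       (\<forall>\<epsilon>. eps_regime_small \<mu> ell R \<sigma> \<beta> \<epsilon> \<longrightarrow>
          (\<exists>K. let \<gamma> = gamma_small \<mu> ell R \<sigma> K \<beta>; m = (\<lambda>k. 1) in
             real (K + 1) \<le> C * iter_small \<mu> ell R \<sigma> \<beta> \<epsilon> \<and>
             real (oracle_calls m K) \<le> C * iter_small \<mu> ell R \<sigma> \<beta> \<epsilon> \<and>
             rate_small \<mu> ell R \<sigma> K \<beta> \<le> \<epsilon> \<and>
             \<P>(\<omega> in M. (norm (sgda_output G \<xi> x0 R \<mu> K \<beta> \<gamma> m \<omega> - xs))\<^sup>2 \<le> \<epsilon>) \<ge> 1 - \<beta>)))"
proof (intro exI[of _ "10 ^ 10 :: real"] conjI allI impI; (elim conjE)?)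
  \<comment> \<open>One constant for all claims: it dominates \<open>3240000000 + 16000000\<close>
    for the calls with large batches, \<open>8000000 * 400\<close> for small batches, and the 9 of
    \<open>implicit_max_le\<close>.\<close>
  show "(0::real) < 10 ^ 10" by simp
next
  fix M :: "'w measure" and D :: "'s measure" and G :: "'s \<Rightarrow> 'a \<Rightarrow> 'a" and F \<xi> x0 xs R \<mu> ell \<sigma> and \<beta> :: real and K :: nat
  assume "clipped_sgda_setting M D G F \<xi> x0 xs R \<mu> ell \<sigma>" and \<beta>: "0 < \<beta>" "\<beta> \<le> 1"
  then interpret clipped_sgda_setting M D G F \<xi> x0 xs R \<mu> ell \<sigma> by simp
  show "let \<gamma> = gamma_large ell K \<beta>; m = batch_large \<mu> ell R \<sigma> K \<beta> in
      cond_a ell K \<beta> \<gamma> \<and> cond_b \<mu> R \<sigma> K \<beta> \<gamma> m \<and>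
      1 - \<beta> \<le> \<P>(\<omega> in M. (norm (sgda_output G \<xi> x0 R \<mu> K \<beta> \<gamma> m \<omega> - xs))\<^sup>2 \<le> rate_large \<mu> ell R K \<beta>)"
    using cond_a_gamma_large[OF ell_pos \<beta>] cond_b_batch_large large_high_probability[OF \<beta> order_refl]
    by (simp add: Let_def)
next
  fix M :: "'w measure" and D :: "'s measure" and G :: "'s \<Rightarrow> 'a \<Rightarrow> 'a" and F \<xi> x0 xs R \<mu> ell \<sigma> and \<beta> \<epsilon> :: real
  assume "clipped_sgda_setting M D G F \<xi> x0 xs R \<mu> ell \<sigma>" and \<beta>: "0 < \<beta>" "\<beta> \<le> 1"
    and \<mu>: "0 < \<mu>" and reg: "eps_regime_large \<mu> ell R \<beta> \<epsilon>"
  then interpret clipped_sgda_setting M D G F \<xi> x0 xs R \<mu> ell \<sigma> by simp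
  obtain K where "real (K + 1) \<le> 10 ^ 10 * iter_large \<mu> ell R \<beta> \<epsilon>"
    "real (oracle_calls (batch_large \<mu> ell R \<sigma> K \<beta>) K) \<le> 10 ^ 10 * calls_large \<mu> ell R \<sigma> \<beta> \<epsilon>"
    "rate_large \<mu> ell R K \<beta> \<le> \<epsilon>"
    using large_complexity[OF \<mu> mu_le_ell R_pos \<beta> reg] .
  then show "\<exists>K. let \<gamma> = gamma_large ell K \<beta>; m = batch_large \<mu> ell R \<sigma> K \<beta> in
      real (K + 1) \<le> 10 ^ 10 * iter_large \<mu> ell R \<beta> \<epsilon> \<and>
      real (oracle_calls m K) \<le> 10 ^ 10 * calls_large \<mu> ell R \<sigma> \<beta> \<epsilon> \<and>
      rate_large \<mu> ell R K \<beta> \<le> \<epsilon> \<and>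
      1 - \<beta> \<le> \<P>(\<omega> in M. (norm (sgda_output G \<xi> x0 R \<mu> K \<beta> \<gamma> m \<omega> - xs))\<^sup>2 \<le> \<epsilon>)"
    unfolding Let_def using large_high_probability[OF \<beta>] by blast
next
  fix M :: "'w measure" and D :: "'s measure" and G :: "'s \<Rightarrow> 'a \<Rightarrow> 'a" and F \<xi> x0 xs R \<mu> ell \<sigma> and \<beta> :: real and K :: nat
  assume "clipped_sgda_setting M D G F \<xi> x0 xs R \<mu> ell \<sigma>" and \<beta>: "0 < \<beta>" "\<beta> \<le> 1"
    and \<mu>\<sigma>: "0 < \<mu>" "0 < \<sigma>"
  then interpret clipped_sgda_setting M D G F \<xi> x0 xs R \<mu> ell \<sigma> by simp
  note pos = \<mu>\<sigma> \<beta>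
  define A where "A = B_arg \<mu> R \<sigma> K \<beta>"
  define B where "B = B_K \<mu> R \<sigma> K \<beta>"
  have A: "0 < A" using B_arg_pos[OF pos] by (simp add: A_def)
  have B: "B = max 2 (A / (ln B)\<^sup>2)" unfolding A_def B_def by (rule B_K_eq[OF B_arg_pos[OF pos]])
  have "B \<le> 10 ^ 10 * max 2 (A / (ln (max 2 A))\<^sup>2)"
    by (rule order_trans[OF implicit_max_le[OF A B] mult_right_mono]) simp_all
  then show "let B = B_K \<mu> R \<sigma> K \<beta>; A = B_arg \<mu> R \<sigma> K \<beta>; \<gamma> = gamma_small \<mu> ell R \<sigma> K \<beta>; m = (\<lambda>k. 1) in
      B = max 2 (A / (ln B)\<^sup>2) \<and>
      B \<le> 10 ^ 10 * max 2 (A / (ln (max 2 A))\<^sup>2) \<and>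
      cond_a ell K \<beta> \<gamma> \<and>
      (2 \<le> A / (ln B)\<^sup>2 \<longrightarrow> cond_b \<mu> R \<sigma> K \<beta> \<gamma> m) \<and>
      (cond_b \<mu> R \<sigma> K \<beta> \<gamma> m \<longrightarrow>
        1 - \<beta> \<le> \<P>(\<omega> in M. (norm (sgda_output G \<xi> x0 R \<mu> K \<beta> \<gamma> m \<omega> - xs))\<^sup>2 \<le> rate_small \<mu> ell R \<sigma> K \<beta>))"
    unfolding Let_def A_def[symmetric] B_def[symmetric]
    using B cond_a_gamma_small[OF pos] cond_b_unit_batch[OF pos, of K, folded A_def B_def]
      small_high_probability[OF pos _ order_refl] by blast
next
  fix M :: "'w measure" and D :: "'s measure" and G :: "'s \<Rightarrow> 'a \<Rightarrow> 'a" and F \<xi> x0 xs R \<mu> ell \<sigma> and \<beta> \<epsilon> :: real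
  assume "clipped_sgda_setting M D G F \<xi> x0 xs R \<mu> ell \<sigma>" and \<beta>: "0 < \<beta>" "\<beta> \<le> 1"
    and \<mu>\<sigma>: "0 < \<mu>" "0 < \<sigma>" and reg: "eps_regime_small \<mu> ell R \<sigma> \<beta> \<epsilon>"
  then interpret clipped_sgda_setting M D G F \<xi> x0 xs R \<mu> ell \<sigma> by simp
  note pos = \<mu>\<sigma> \<beta>
  obtain K where K: "real (K + 1) \<le> 10 ^ 10 * iter_small \<mu> ell R \<sigma> \<beta> \<epsilon>"
    "rate_small \<mu> ell R \<sigma> K \<beta> \<le> \<epsilon>" "2 \<le> B_arg \<mu> R \<sigma> K \<beta> / (ln (B_K \<mu> R \<sigma> K \<beta>))\<^sup>2"
    using small_complexity[OF \<mu>\<sigma>(1) mu_le_ell R_pos \<mu>\<sigma>(2) \<beta> reg] .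
  have "oracle_calls (\<lambda>k. 1) K = K + 1" by (simp add: oracle_calls_def)
  then show "\<exists>K. let \<gamma> = gamma_small \<mu> ell R \<sigma> K \<beta>; m = (\<lambda>k. 1) in
      real (K + 1) \<le> 10 ^ 10 * iter_small \<mu> ell R \<sigma> \<beta> \<epsilon> \<and>
      real (oracle_calls m K) \<le> 10 ^ 10 * iter_small \<mu> ell R \<sigma> \<beta> \<epsilon> \<and>
      rate_small \<mu> ell R \<sigma> K \<beta> \<le> \<epsilon> \<and>
      1 - \<beta> \<le> \<P>(\<omega> in M. (norm (sgda_output G \<xi> x0 R \<mu> K \<beta> \<gamma> m \<omega> - xs))\<^sup>2 \<le> \<epsilon>)"
    unfolding Let_def
    using K small_high_probability[OF pos cond_b_unit_batch[OF pos K(3)] K(2)] by auto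
qed

end
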